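(* Let $M$ be a real smooth, of class $C^1$, differentiable manifold and let $L$ be a flat linear transport over $M$, smooth of class $C^1$. Then the linear connection $\nabla^L$ generated by $L$ is flat.
   Context: $T^{p,q}_x(M)$ is the space of tensors of type $(p,q)$ at $x\in M$. A flat linear transport (of tensors) over $M$ is a map $L:(x,y)\mapsto L_{x\to y}$, $x,y\in M$, where $L_{x\to y}$ maps the tensor algebra at $x$ into the tensor algebra at $y$, such that for all $x,y,z\in M$ and all types: (i) $L_{x\to y}(T^{p,q}_x(M))\subseteq T^{p,q}_y(M)$; (ii) $L_{x\to y}$ is linear on each $T^{p,q}_x(M)$; (iii) $L_{x\to y}(A_1\otimes A_2)=(L_{x\to y}A_1)\otimes(L_{x\to y}A_2)$; (iv) $L_{x\to y}\circ C=C\circ L_{x\to y}$ for every contraction operator $C$; (v) $L_{y\to z}\circ L_{x\to y}=L_{x\to z}$; (vi) $L_{x\to x}=\mathrm{id}$. For a field of bases $\{E_i\}$ of the tangent spaces with dual bases $\{E^i\}$, write $L_{x\to y}(E_j(x))=H^{i}{}_{j}(y,x)E_i(y)$ (summation over repeated indices); $L$ is smooth of class $C^1$ if the bivector $H(y,x)=H^{i}{}_{j}(y,x)E_i(y)\otimes E^j(x)$ and its inverse bivector are of class $C^1$. The linear connection generated by $L$ is $\nabla^L:V\mapsto\nabla^L_V$, $(\nabla^L_VS)(x):=\lim_{\varepsilon\to0}\frac1\varepsilon\bigl(L_{x_\varepsilon\to x}S(x_\varepsilon)-S(x)\bigr)$ for vector fields $V$ and $C^1$ tensor fields $S$, where in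 some local coordinates around $x$ the point $x_\varepsilon$ has coordinates $x^i+\varepsilon V^i|_x$, $V|_x=V^i|_x\,\partial/\partial x^i$. A linear connection $\nabla$ is flat if its curvature operator $R(A,B):=\nabla_A\circ\nabla_B-\nabla_B\circ\nabla_A-\nabla_{[A,B]}$ ($A,B$ being $C^1$ or smoother vector fields for which the expression is formed, $[A,B]:=A\circ B-B\circ A$) vanishes. *)

theory Defs
  imports "HOL-Analysis.Analysis"
begin

definition C1_on :: "'a::real_normed_vector set \<Rightarrow> ('a \<Rightarrow> 'b::real_normed_vector) \<Rightarrow> bool" where
  "C1_on W f \<longleftrightarrow>
    (\<exists>f'. (\<forall>u\<in>W. (f has_derivative blinfun_apply (f' u)) (at u)) \<and> continuous_on W f')"

type_synonym ('a, 'n) chart = "'a set \<times> ('a \<Rightarrow> real ^ 'n)"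

abbreviation dom_chart :: "('a, 'n) chart \<Rightarrow> 'a set" where
  "dom_chart c \<equiv> fst c"

abbreviation img_chart :: "('a, 'n) chart \<Rightarrow> (real ^ 'n) set" where
  "img_chart c \<equiv> snd c ` fst c"

definition inv_chart :: "('a, 'n) chart \<Rightarrow> real ^ 'n \<Rightarrow> 'a" where
  "inv_chart c = inv_into (fst c) (snd c)"

definition coord :: "('a, 'n::finite) chart \<Rightarrow> 'n \<Rightarrow> 'a \<Rightarrow> real" where
  "coord c i y = snd c y $ i"

text \<open>The atlas is not required to be maximal: below, a tensor field is \<open>C\<^sup>1\<close> if its components in
  every chart of the given atlas are \<open>C\<^sup>1\<close>. An atlas with \<open>C\<^sup>2\<close> or smoother transition maps is
  in particular allowed, and for it this is the usual notion. (For a maximal \<open>C\<^sup>1\<close> atlas,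
  whose coordinate frames are merely \<open>C\<^sup>0\<close>-related, almost no field is \<open>C\<^sup>1\<close>.)
  Second countability is not assumed.\<close>

definition C1_manifold :: "'a topology \<Rightarrow> ('a, 'n::finite) chart set \<Rightarrow> bool" where
  "C1_manifold M \<A> \<longleftrightarrow>
     Hausdorff_space M \<and>
     topspace M = (\<Union>c\<in>\<A>. dom_chart c) \<and>
     (\<forall>c\<in>\<A>. openin M (dom_chart c) \<and> open (img_chart c) \<and>
        homeomorphic_map (subtopology M (dom_chart c)) (top_of_set (img_chart c)) (snd c)) \<and>
     (\<forall>c\<in>\<A>. \<forall>d\<in>\<A>. C1_on (snd c ` (dom_chart c \<inter> dom_chart d)) (snd d \<circ> inv_chart c))"

definition chart_at :: "('a, 'n) chart set \<Rightarrow> 'a \<Rightarrow> ('a, 'n) chart" where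
  "chart_at \<A> x = (SOME c. c \<in> \<A> \<and> x \<in> dom_chart c)"

definition C1_near :: "'a topology \<Rightarrow> ('a, 'n::finite) chart set \<Rightarrow> 'a \<Rightarrow> ('a \<Rightarrow> real) \<Rightarrow> bool" where
  "C1_near M \<A> x f \<longleftrightarrow>
     (\<exists>N. openin M N \<and> x \<in> N \<and>
        (\<forall>c\<in>\<A>. C1_on (snd c ` (dom_chart c \<inter> N)) (f \<circ> inv_chart c)))"

type_synonym 'a tvec = "('a \<Rightarrow> real) \<Rightarrow> real"
type_synonym 'a tcov = "'a tvec \<Rightarrow> real"
type_synonym 'a tensor = "'a tcov list \<Rightarrow> 'a tvec list \<Rightarrow> real"

text \<open>Tangent vectors are the operators \<open>a\<^sup>i \<partial>/\<partial>x\<^sup>i\<close> on functions that are \<open>C\<^sup>1\<close> near the point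
  (extended by \<open>0\<close> to all other functions). They are not defined as derivations, because the
  space of all derivations of germs of \<open>C\<^sup>1\<close> functions is infinite-dimensional.\<close>

definition chart_vec ::
  "'a topology \<Rightarrow> ('a, 'n::finite) chart set \<Rightarrow> ('a, 'n) chart \<Rightarrow> 'a \<Rightarrow> real ^ 'n \<Rightarrow> 'a tvec" where
  "chart_vec M \<A> c x a =
     (\<lambda>f. if C1_near M \<A> x f
          then frechet_derivative (f \<circ> inv_chart c) (at (snd c x)) a else 0)"

definition tangent_space :: "'a topology \<Rightarrow> ('a, 'n::finite) chart set \<Rightarrow> 'a \<Rightarrow> 'a tvec set" where
  "tangent_space M \<A> x = {chart_vec M \<A> c x a | c a. c \<in> \<A> \<and> x \<in> dom_chart c}"

text \<open>Covectors and tensors are (multi)linear maps, set to \<open>0\<close> outside their domain, so that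
  equality of functions is equality of tensors.\<close>

definition cotangent_space :: "'a topology \<Rightarrow> ('a, 'n::finite) chart set \<Rightarrow> 'a \<Rightarrow> 'a tcov set" where
  "cotangent_space M \<A> x =
     {\<alpha>. (\<forall>v\<in>tangent_space M \<A> x. \<forall>w\<in>tangent_space M \<A> x. \<forall>r.
             \<alpha> (\<lambda>f. v f + r * w f) = \<alpha> v + r * \<alpha> w) \<and>
          (\<forall>v. v \<notin> tangent_space M \<A> x \<longrightarrow> \<alpha> v = 0)}"

definition basis_vec ::
  "'a topology \<Rightarrow> ('a, 'n::finite) chart set \<Rightarrow> ('a, 'n) chart \<Rightarrow> 'a \<Rightarrow> 'n \<Rightarrow> 'a tvec" where
  "basis_vec M \<A> c x i = chart_vec M \<A> c x (axis i 1)"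

definition basis_cov ::
  "'a topology \<Rightarrow> ('a, 'n::finite) chart set \<Rightarrow> ('a, 'n) chart \<Rightarrow> 'a \<Rightarrow> 'n \<Rightarrow> 'a tcov" where
  "basis_cov M \<A> c x i = (\<lambda>v. if v \<in> tangent_space M \<A> x then v (coord c i) else 0)"

definition tensor_space ::
  "'a topology \<Rightarrow> ('a, 'n::finite) chart set \<Rightarrow> nat \<Rightarrow> nat \<Rightarrow> 'a \<Rightarrow> 'a tensor set" where
  "tensor_space M \<A> p q x =
     {t. (\<forall>\<alpha>s vs. \<not> (length \<alpha>s = p \<and> set \<alpha>s \<subseteq> cotangent_space M \<A> x \<and>
                     length vs = q \<and> set vs \<subseteq> tangent_space M \<A> x) \<longrightarrow> t \<alpha>s vs = 0) \<and>
         (\<forall>\<alpha>s vs. length \<alpha>s = p \<and> set \<alpha>s \<subseteq> cotangent_space M \<A> x \<and>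
                   length vs = q \<and> set vs \<subseteq> tangent_space M \<A> x \<longrightarrow>
            (\<forall>k<p. \<forall>\<alpha>\<in>cotangent_space M \<A> x. \<forall>\<beta>\<in>cotangent_space M \<A> x. \<forall>r.
               t (\<alpha>s[k := (\<lambda>v. \<alpha> v + r * \<beta> v)]) vs = t (\<alpha>s[k := \<alpha>]) vs + r * t (\<alpha>s[k := \<beta>]) vs) \<and>
            (\<forall>k<q. \<forall>v\<in>tangent_space M \<A> x. \<forall>w\<in>tangent_space M \<A> x. \<forall>r.
               t \<alpha>s (vs[k := (\<lambda>f. v f + r * w f)]) = t \<alpha>s (vs[k := v]) + r * t \<alpha>s (vs[k := w])))}"

text \<open>\<open>tensor_prod p q s t\<close> is \<open>s \<otimes> t\<close> for \<open>s\<close> of type \<open>(p,q)\<close>.\<close>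

definition tensor_prod :: "nat \<Rightarrow> nat \<Rightarrow> 'a tensor \<Rightarrow> 'a tensor \<Rightarrow> 'a tensor" where
  "tensor_prod p q s t = (\<lambda>\<alpha>s vs. s (take p \<alpha>s) (take q vs) * t (drop p \<alpha>s) (drop q vs))"

definition insert_at :: "nat \<Rightarrow> 'b \<Rightarrow> 'b list \<Rightarrow> 'b list" where
  "insert_at k z zs = take k zs @ z # drop k zs"

text \<open>Contraction of the contravariant slot \<open>a\<close> with the covariant slot \<open>b\<close> (counted from \<open>0\<close>).
  The result does not depend on the basis, so the coordinate basis of any chart may be used.\<close>

definition contract ::
  "'a topology \<Rightarrow> ('a, 'n::finite) chart set \<Rightarrow> 'a \<Rightarrow> nat \<Rightarrow> nat \<Rightarrow> 'a tensor \<Rightarrow> 'a tensor" where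
  "contract M \<A> x a b t = (\<lambda>\<alpha>s vs. \<Sum>i\<in>UNIV.
      t (insert_at a (basis_cov M \<A> (chart_at \<A> x) x i) \<alpha>s)
        (insert_at b (basis_vec M \<A> (chart_at \<A> x) x i) vs))"

text \<open>A tangent vector regarded as a tensor of type \<open>(1,0)\<close>.\<close>

definition vec_tensor :: "'a topology \<Rightarrow> ('a, 'n::finite) chart set \<Rightarrow> 'a \<Rightarrow> 'a tvec \<Rightarrow> 'a tensor" where
  "vec_tensor M \<A> x v = (\<lambda>\<alpha>s vs.
      if length \<alpha>s = 1 \<and> set \<alpha>s \<subseteq> cotangent_space M \<A> x \<and> vs = [] then hd \<alpha>s v else 0)"

definition vector_field :: "'a topology \<Rightarrow> ('a, 'n::finite) chart set \<Rightarrow> ('a \<Rightarrow> 'a tvec) \<Rightarrow> bool" where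
  "vector_field M \<A> X \<longleftrightarrow> (\<forall>x\<in>topspace M. X x \<in> tangent_space M \<A> x)"

definition C1_vector_field :: "'a topology \<Rightarrow> ('a, 'n::finite) chart set \<Rightarrow> ('a \<Rightarrow> 'a tvec) \<Rightarrow> bool" where
  "C1_vector_field M \<A> X \<longleftrightarrow> vector_field M \<A> X \<and>
     (\<forall>c\<in>\<A>. \<forall>i. C1_on (img_chart c) (\<lambda>u. X (inv_chart c u) (coord c i)))"

definition C1_tensor_field ::
  "'a topology \<Rightarrow> ('a, 'n::finite) chart set \<Rightarrow> nat \<Rightarrow> nat \<Rightarrow> ('a \<Rightarrow> 'a tensor) \<Rightarrow> bool" where
  "C1_tensor_field M \<A> p q S \<longleftrightarrow>
     (\<forall>x\<in>topspace M. S x \<in> tensor_space M \<A> p q x) \<and>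
     (\<forall>c\<in>\<A>. \<forall>is js. length is = p \<and> length js = q \<longrightarrow>
        C1_on (img_chart c)
          (\<lambda>u. S (inv_chart c u) (map (basis_cov M \<A> c (inv_chart c u)) is)
                                 (map (basis_vec M \<A> c (inv_chart c u)) js)))"

text \<open>\<open>[X,Y] = X \<circ> Y - Y \<circ> X\<close>, on the functions for which the right-hand side is formed. If \<open>X\<close> and
  \<open>Y\<close> are \<open>C\<^sup>1\<close>, these include the coordinate functions, which determine the tangent vector.\<close>

definition lie_bracket ::
  "'a topology \<Rightarrow> ('a, 'n::finite) chart set \<Rightarrow> ('a \<Rightarrow> 'a tvec) \<Rightarrow> ('a \<Rightarrow> 'a tvec) \<Rightarrow> 'a \<Rightarrow> 'a tvec" where
  "lie_bracket M \<A> X Y x = (THE w. w \<in> tangent_space M \<A> x \<and>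
     (\<forall>f. C1_near M \<A> x f \<and> C1_near M \<A> x (\<lambda>y. X y f) \<and> C1_near M \<A> x (\<lambda>y. Y y f) \<longrightarrow>
        w f = X x (\<lambda>y. Y y f) - Y x (\<lambda>y. X y f)))"

text \<open>\<open>L x y\<close> is the transport from \<open>x\<close> to \<open>y\<close>. The axioms constrain it on homogeneous tensors.\<close>

definition flat_linear_transport ::
  "'a topology \<Rightarrow> ('a, 'n::finite) chart set \<Rightarrow> ('a \<Rightarrow> 'a \<Rightarrow> 'a tensor \<Rightarrow> 'a tensor) \<Rightarrow> bool" where
  "flat_linear_transport M \<A> L \<longleftrightarrow>
     (\<forall>x\<in>topspace M. \<forall>y\<in>topspace M. \<forall>p q.
        (\<forall>t\<in>tensor_space M \<A> p q x. L x y t \<in> tensor_space M \<A> p q y) \<and>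
        (\<forall>s\<in>tensor_space M \<A> p q x. \<forall>t\<in>tensor_space M \<A> p q x. \<forall>r.
           L x y (\<lambda>\<alpha>s vs. s \<alpha>s vs + r * t \<alpha>s vs) = (\<lambda>\<alpha>s vs. L x y s \<alpha>s vs + r * L x y t \<alpha>s vs)) \<and>
        (\<forall>p' q'. \<forall>s\<in>tensor_space M \<A> p q x. \<forall>t\<in>tensor_space M \<A> p' q' x.
           L x y (tensor_prod p q s t) = tensor_prod p q (L x y s) (L x y t)) \<and>
        (\<forall>a\<le>p. \<forall>b\<le>q. \<forall>t\<in>tensor_space M \<A> (Suc p) (Suc q) x.
           L x y (contract M \<A> x a b t) = contract M \<A> y a b (L x y t)) \<and>
        (\<forall>z\<in>topspace M. \<forall>t\<in>tensor_space M \<A> p q x. L y z (L x y t) = L x z t) \<and>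
        (\<forall>t\<in>tensor_space M \<A> p q x. L x x t = t))"

text \<open>The matrix \<open>H\<^sup>i\<^sub>j(y,x)\<close> in the coordinate bases of \<open>d\<close> at \<open>y\<close> and \<open>c\<close> at \<open>x\<close>, that is,
  \<open>L x y (E\<^sub>j(x)) = H\<^sup>i\<^sub>j(y,x) E\<^sub>i(y)\<close>.\<close>

definition transport_matrix ::
  "'a topology \<Rightarrow> ('a, 'n::finite) chart set \<Rightarrow> ('a \<Rightarrow> 'a \<Rightarrow> 'a tensor \<Rightarrow> 'a tensor) \<Rightarrow>
   ('a, 'n) chart \<Rightarrow> ('a, 'n) chart \<Rightarrow> 'a \<Rightarrow> 'a \<Rightarrow> real ^ 'n ^ 'n" where
  "transport_matrix M \<A> L d c y x =
     (\<chi> i j. L x y (vec_tensor M \<A> x (basis_vec M \<A> c x j)) [basis_cov M \<A> d y i] [])"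

definition C1_transport ::
  "'a topology \<Rightarrow> ('a, 'n::finite) chart set \<Rightarrow> ('a \<Rightarrow> 'a \<Rightarrow> 'a tensor \<Rightarrow> 'a tensor) \<Rightarrow> bool" where
  "C1_transport M \<A> L \<longleftrightarrow> (\<forall>d\<in>\<A>. \<forall>c\<in>\<A>.
     C1_on (img_chart d \<times> img_chart c)
       (\<lambda>(u, v). transport_matrix M \<A> L d c (inv_chart d u) (inv_chart c v)) \<and>
     C1_on (img_chart d \<times> img_chart c)
       (\<lambda>(u, v). matrix_inv (transport_matrix M \<A> L d c (inv_chart d u) (inv_chart c v))))"

definition shifted_point ::
  "('a, 'n::finite) chart set \<Rightarrow> ('a \<Rightarrow> 'a tvec) \<Rightarrow> 'a \<Rightarrow> real \<Rightarrow> 'a" where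
  "shifted_point \<A> V x \<epsilon> =
     (let c = chart_at \<A> x in inv_chart c (snd c x + \<epsilon> *\<^sub>R (\<chi> i. V x (coord c i))))"

text \<open>Each space of tensors of type \<open>(p,q)\<close> at \<open>x\<close> is finite-dimensional, so convergence in it is
  convergence at every argument. The limit exists for \<open>C\<^sup>1\<close> transports and \<open>C\<^sup>1\<close> fields \<open>S\<close>.\<close>

definition generated_connection ::
  "('a, 'n::finite) chart set \<Rightarrow> ('a \<Rightarrow> 'a \<Rightarrow> 'a tensor \<Rightarrow> 'a tensor) \<Rightarrow>
   ('a \<Rightarrow> 'a tvec) \<Rightarrow> ('a \<Rightarrow> 'a tensor) \<Rightarrow> 'a \<Rightarrow> 'a tensor" where
  "generated_connection \<A> L V S x = (\<lambda>\<alpha>s vs. Lim (at 0) (\<lambda>\<epsilon>::real.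
     (1 / \<epsilon>) * (L (shifted_point \<A> V x \<epsilon>) x (S (shifted_point \<A> V x \<epsilon>)) \<alpha>s vs - S x \<alpha>s vs)))"

definition curvature ::
  "'a topology \<Rightarrow> ('a, 'n::finite) chart set \<Rightarrow>
   (('a \<Rightarrow> 'a tvec) \<Rightarrow> ('a \<Rightarrow> 'a tensor) \<Rightarrow> 'a \<Rightarrow> 'a tensor) \<Rightarrow>
   ('a \<Rightarrow> 'a tvec) \<Rightarrow> ('a \<Rightarrow> 'a tvec) \<Rightarrow> ('a \<Rightarrow> 'a tensor) \<Rightarrow> 'a \<Rightarrow> 'a tensor" where
  "curvature M \<A> D X Y S x = (\<lambda>\<alpha>s vs.
     D X (D Y S) x \<alpha>s vs - D Y (D X S) x \<alpha>s vs - D (lie_bracket M \<A> X Y) S x \<alpha>s vs)"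

text \<open>As connections act on \<open>C\<^sup>1\<close> tensor fields, \<open>R(X,Y)S\<close> is formed when \<open>S\<close>, \<open>D X S\<close> and
  \<open>D Y S\<close> are \<open>C\<^sup>1\<close>.\<close>

definition flat_connection ::
  "'a topology \<Rightarrow> ('a, 'n::finite) chart set \<Rightarrow>
   (('a \<Rightarrow> 'a tvec) \<Rightarrow> ('a \<Rightarrow> 'a tensor) \<Rightarrow> 'a \<Rightarrow> 'a tensor) \<Rightarrow> bool" where
  "flat_connection M \<A> D \<longleftrightarrow>
     (\<forall>X Y p q S. C1_vector_field M \<A> X \<and> C1_vector_field M \<A> Y \<and> C1_tensor_field M \<A> p q S \<and>
        C1_tensor_field M \<A> p q (D X S) \<and> C1_tensor_field M \<A> p q (D Y S) \<longrightarrow>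
        (\<forall>x\<in>topspace M. curvature M \<A> D X Y S x = (\<lambda>\<alpha>s vs. 0)))"

end

theory Submission
  imports Defs
begin

text \<open>
  Fix a point \<open>x\<close> and arguments \<open>\<alpha>s\<close>, \<open>vs\<close> (covectors and vectors at \<open>x\<close>), and attach to a tensor
  field \<open>T\<close> the real function \<open>\<phi> T = (\<lambda>z. L z x (T z) \<alpha>s vs)\<close>: all values of the field are
  transported to \<open>x\<close> and evaluated there. Since \<open>L\<close> is path independent, transporting \<open>T\<close> from \<open>z\<close>
  to \<open>y\<close> and then to \<open>x\<close> is the same as going to \<open>x\<close> directly. The difference quotients in the
  definition of the generated connection at \<open>y\<close> therefore become difference quotients of \<open>\<phi> T\<close>, and
  \<open>\<phi> (D V T) = V (\<phi> T)\<close> on all of the manifold. In other words, the transport turns covariant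
  differentiation into differentiation of functions with values in the fixed tensor space at \<open>x\<close>, and
  the curvature evaluated at \<open>\<alpha>s\<close>, \<open>vs\<close> becomes \<open>X (Y f) - Y (X f) - [X,Y] f\<close> with \<open>f = \<phi> S\<close>.

  Two points need work.

  The first is that \<open>\<phi> S\<close> is \<open>C\<^sup>1\<close>, although smoothness of \<open>L\<close> is given for vectors only. Compatibility
  with tensor products and contractions forces \<open>L\<close> to preserve the evaluation of a tensor on its
  arguments (\<open>transport_preserves_evaluation\<close>): inserting an argument is a tensor product followed by
  a contraction, and scalars are transported identically. Hence \<open>L z x (S z) \<alpha>s vs\<close> is \<open>S z\<close>
  evaluated on the arguments transported from \<open>x\<close> to \<open>z\<close>. The components of these arguments are
  linear in the entries of the transport matrices, so \<open>\<phi> S\<close> is \<open>C\<^sup>1\<close>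
  (\<open>transported_component_C1\<close>).

  The second is that the bracket identity \<open>[X,Y] f = X (Y f) - Y (X f)\<close> has to hold for a function
  \<open>f\<close> that is merely \<open>C\<^sup>1\<close>, as long as \<open>X f\<close> and \<open>Y f\<close> are \<open>C\<^sup>1\<close>; no second derivative of \<open>f\<close>
  exists a priori. In a chart, replacing the coefficients of \<open>X\<close> and \<open>Y\<close> by their values at the point
  gives directional derivatives that are still differentiable at that point
  (\<open>has_derivative_frozen_argument\<close>), and for constant directions the symmetry of the mixed
  derivatives follows from the mean value theorem under exactly this hypothesis
  (\<open>mixed_directional_derivatives_commute\<close>). This is also what makes the Lie bracket, which is
  defined by a definite description, a tangent vector with the expected property.
\<close>

section \<open>Commutators of directional derivatives of a continuously differentiable function\<close>

text \<open>By the mean value theorem along \<open>v\<close>, the second difference is \<open>s\<close> times an increment of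
  \<open>u \<mapsto> F' u v\<close> over \<open>s w\<close>, and differentiability of that function at the single point \<open>u0\<close>
  determines the increment up to \<open>o(s)\<close>. The second difference is symmetric in \<open>v\<close> and \<open>w\<close>, which is
  why this yields the symmetry of mixed derivatives.\<close>

lemma second_difference_estimate:
  fixes F :: "'e::real_normed_vector \<Rightarrow> real"
  assumes W: "open W" "u0 \<in> W"
    and F: "\<And>u. u \<in> W \<Longrightarrow> (F has_derivative F' u) (at u)"
    and P: "((\<lambda>u. F' u v) has_derivative P) (at u0)"
    and e: "e > 0"
  shows "\<exists>d>0. \<forall>s. 0 < s \<and> s < d \<longrightarrow>
    \<bar>F (u0 + s *\<^sub>R v + s *\<^sub>R w) - F (u0 + s *\<^sub>R v) - F (u0 + s *\<^sub>R w) + F u0 - s\<^sup>2 * P w\<bar> \<le> e * s\<^sup>2"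
proof -
  \<comment> \<open>All points used below lie within \<open>s * K\<close> of \<open>u0\<close>. The vector \<open>v\<close> is counted twice because
    two error terms involve it, and \<open>1\<close> is added to keep \<open>K\<close> positive.\<close>
  define K where "K = 2 * norm v + norm w + 1"
  have K: "K > 0"
    unfolding K_def by (simp add: add_nonneg_pos)
  define e' where "e' = e / K"
  have e': "e' > 0" using e K by (simp add: e'_def)
  have P_lin: "bounded_linear P"
    using P by (rule has_derivative_bounded_linear)
  obtain d1 where d1: "d1 > 0"
    "\<And>u. norm (u - u0) < d1 \<Longrightarrow> \<bar>F' u v - F' u0 v - P (u - u0)\<bar> \<le> e' * norm (u - u0)"
    using P e' unfolding has_derivative_at_alt real_norm_def by blast
  obtain d2 where d2: "d2 > 0" "ball u0 d2 \<subseteq> W"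
    using W open_contains_ball by blast
  define d where "d = min d1 d2 / K"
  have "d > 0" using d1 d2 K by (simp add: d_def)
  moreover have "\<bar>F (u0 + s *\<^sub>R v + s *\<^sub>R w) - F (u0 + s *\<^sub>R v) - F (u0 + s *\<^sub>R w) + F u0 - s\<^sup>2 * P w\<bar> \<le> e * s\<^sup>2"
    if s: "0 < s" "s < d" for s
  proof -
    have sK: "s * K < min d1 d2"
      using s K by (simp add: d_def pos_less_divide_eq)
    have small: "norm (r *\<^sub>R v + t *\<^sub>R w) < min d1 d2"
      if "0 \<le> r" "r \<le> s" "0 \<le> t" "t \<le> s" for r t
    proof -
      have "norm (r *\<^sub>R v + t *\<^sub>R w) \<le> r * norm v + t * norm w"
        using norm_triangle_ineq[of "r *\<^sub>R v" "t *\<^sub>R w"] that by simp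
      also have "\<dots> \<le> s * norm v + s * norm w"
        using that by (intro add_mono mult_right_mono) auto
      also have "\<dots> \<le> s * K"
        using s by (simp add: K_def algebra_simps)
      finally show ?thesis using sK by simp
    qed
    have inW: "u0 + r *\<^sub>R v + t *\<^sub>R w \<in> W"
      if "0 \<le> r" "r \<le> s" "0 \<le> t" "t \<le> s" for r t
    proof -
      have "u0 + (r *\<^sub>R v + t *\<^sub>R w) \<in> ball u0 d2"
        using small[OF that] by (subst mem_ball, subst dist_commute) (simp add: dist_norm)
      then show ?thesis using d2 by (auto simp: add.assoc)
    qed
    define g where "g = (\<lambda>r. F (u0 + r *\<^sub>R v + s *\<^sub>R w) - F (u0 + r *\<^sub>R v))"
    define g' where "g' = (\<lambda>r. F' (u0 + r *\<^sub>R v + s *\<^sub>R w) v - F' (u0 + r *\<^sub>R v) v)"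
    have deriv_line: "((\<lambda>r. F (u0 + r *\<^sub>R v + t *\<^sub>R w)) has_real_derivative
        F' (u0 + r *\<^sub>R v + t *\<^sub>R w) v) (at r)"
      if "0 \<le> r" "r \<le> s" "0 \<le> t" "t \<le> s" for r t
    proof -
      have "((\<lambda>r. u0 + r *\<^sub>R v + t *\<^sub>R w) has_derivative (\<lambda>h. h *\<^sub>R v)) (at r)"
        by (auto intro!: derivative_eq_intros)
      from has_derivative_compose[OF this F[OF inW[OF that]]]
      have *: "((\<lambda>r. F (u0 + r *\<^sub>R v + t *\<^sub>R w)) has_derivative
          (\<lambda>h. F' (u0 + r *\<^sub>R v + t *\<^sub>R w) (h *\<^sub>R v))) (at r)" .
      have "bounded_linear (F' (u0 + r *\<^sub>R v + t *\<^sub>R w))"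
        using F[OF inW[OF that]] by (rule has_derivative_bounded_linear)
      then have "(\<lambda>h. F' (u0 + r *\<^sub>R v + t *\<^sub>R w) (h *\<^sub>R v)) = (\<lambda>h. F' (u0 + r *\<^sub>R v + t *\<^sub>R w) v * h)"
        by (simp add: linear_simps(5) mult.commute)
      then show ?thesis
        using * unfolding has_field_derivative_def by simp
    qed
    have "(g has_real_derivative g' r) (at r)" if "0 \<le> r" "r \<le> s" for r
      unfolding g_def g'_def
      using deriv_line[of r s] deriv_line[of r 0] that s by (intro DERIV_diff) auto
    then obtain r where r: "0 < r" "r < s" "g s - g 0 = (s - 0) * g' r"
      using MVT2[of 0 s g g'] s by auto
    have est: "\<bar>F' (u0 + r *\<^sub>R v + t *\<^sub>R w) v - F' u0 v - P (r *\<^sub>R v + t *\<^sub>R w)\<bar>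
        \<le> e' * norm (r *\<^sub>R v + t *\<^sub>R w)" if "0 \<le> t" "t \<le> s" for t
      using d1(2)[of "u0 + r *\<^sub>R v + t *\<^sub>R w"] small[of r t] r that by (simp add: add.assoc)
    have Ps: "P (r *\<^sub>R v + s *\<^sub>R w) - P (r *\<^sub>R v) = s * P w"
      using P_lin by (simp add: linear_simps)
    have "\<bar>g' r - s * P w\<bar> \<le> e' * norm (r *\<^sub>R v + s *\<^sub>R w) + e' * norm (r *\<^sub>R v)"
      using est[of s] est[of 0] s Ps unfolding g'_def by (simp add: abs_le_iff)
    also have "\<dots> = e' * (norm (r *\<^sub>R v + s *\<^sub>R w) + norm (r *\<^sub>R v))"
      by (simp add: algebra_simps)
    also have "\<dots> \<le> e' * (s * K)"
    proof (rule mult_left_mono)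
      have "norm (r *\<^sub>R v + s *\<^sub>R w) + norm (r *\<^sub>R v) \<le> 2 * (r * norm v) + s * norm w"
        using norm_triangle_ineq[of "r *\<^sub>R v" "s *\<^sub>R w"] r s by simp
      also have "\<dots> \<le> 2 * (s * norm v) + s * norm w"
        using r by (simp add: mult_right_mono)
      also have "\<dots> \<le> s * K" using s by (simp add: K_def algebra_simps)
      finally show "norm (r *\<^sub>R v + s *\<^sub>R w) + norm (r *\<^sub>R v) \<le> s * K" .
    qed (use e' in simp)
    also have "\<dots> = e * s" using K by (simp add: e'_def)
    finally have "s * \<bar>g' r - s * P w\<bar> \<le> s * (e * s)"
      using s by (intro mult_left_mono) auto
    moreover have "F (u0 + s *\<^sub>R v + s *\<^sub>R w) - F (u0 + s *\<^sub>R v) - F (u0 + s *\<^sub>R w) + F u0 - s\<^sup>2 * P w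
        = s * (g' r - s * P w)"
      using r(3) by (simp add: g_def algebra_simps power2_eq_square)
    moreover have "\<bar>s * (g' r - s * P w)\<bar> = s * \<bar>g' r - s * P w\<bar>"
      using s by (simp add: abs_mult)
    moreover have "s * (e * s) = e * s\<^sup>2"
      by (simp add: power2_eq_square)
    ultimately show ?thesis by simp
  qed
  ultimately show ?thesis by blast
qed

text \<open>Both values are the limit of the same second difference divided by \<open>s\<^sup>2\<close>.\<close>

lemma mixed_directional_derivatives_commute:
  fixes F :: "'e::real_normed_vector \<Rightarrow> real"
  assumes W: "open W" "u0 \<in> W"
    and F: "\<And>u. u \<in> W \<Longrightarrow> (F has_derivative F' u) (at u)"
    and P: "((\<lambda>u. F' u v) has_derivative P) (at u0)"
    and Q: "((\<lambda>u. F' u w) has_derivative Q) (at u0)"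
  shows "P w = Q v"
proof (rule ccontr)
  assume "P w \<noteq> Q v"
  define e where "e = \<bar>P w - Q v\<bar> / 3"
  have e: "e > 0" using \<open>P w \<noteq> Q v\<close> by (simp add: e_def)
  obtain d1 where d1: "d1 > 0" "\<And>s. 0 < s \<Longrightarrow> s < d1 \<Longrightarrow>
    \<bar>F (u0 + s *\<^sub>R v + s *\<^sub>R w) - F (u0 + s *\<^sub>R v) - F (u0 + s *\<^sub>R w) + F u0 - s\<^sup>2 * P w\<bar> \<le> e * s\<^sup>2"
    using second_difference_estimate[OF W F P e] by blast
  obtain d2 where d2: "d2 > 0" "\<And>s. 0 < s \<Longrightarrow> s < d2 \<Longrightarrow>
    \<bar>F (u0 + s *\<^sub>R w + s *\<^sub>R v) - F (u0 + s *\<^sub>R w) - F (u0 + s *\<^sub>R v) + F u0 - s\<^sup>2 * Q v\<bar> \<le> e * s\<^sup>2"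
    using second_difference_estimate[OF W F Q e] by blast
  define s where "s = min d1 d2 / 2"
  have s: "0 < s" "s < d1" "s < d2" using d1 d2 by (auto simp: s_def)
  have "u0 + s *\<^sub>R w + s *\<^sub>R v = u0 + s *\<^sub>R v + s *\<^sub>R w" by simp
  from d1(2)[OF s(1,2)] d2(2)[OF s(1,3), unfolded this]
  have "\<bar>s\<^sup>2 * P w - s\<^sup>2 * Q v\<bar> \<le> 2 * (e * s\<^sup>2)"
    by linarith
  moreover have "\<bar>s\<^sup>2 * P w - s\<^sup>2 * Q v\<bar> = s\<^sup>2 * \<bar>P w - Q v\<bar>"
    by (simp add: right_diff_distrib[symmetric] abs_mult)
  moreover have "2 * (e * s\<^sup>2) = s\<^sup>2 * (2 * e)" by simp
  ultimately have "s\<^sup>2 * \<bar>P w - Q v\<bar> \<le> s\<^sup>2 * (2 * e)" by simp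
  then show False using s e by (simp add: e_def)
qed

text \<open>Although \<open>F'\<close> is only continuous, the error made by replacing \<open>X u\<close> by \<open>X u0\<close> is differentiable
  at \<open>u0\<close>: as \<open>X u - X u0\<close> is \<open>O(u - u0)\<close>, replacing \<open>F' u\<close> by \<open>F' u0\<close> in
  \<open>F' u (X u - X u0)\<close> changes it by \<open>o(u - u0)\<close> only.\<close>

lemma has_derivative_frozen_argument:
  fixes F' :: "'e::real_normed_vector \<Rightarrow> 'e \<Rightarrow>\<^sub>L real"
  assumes cont: "isCont F' u0"
    and X: "(X has_derivative X') (at u0)"
    and h: "((\<lambda>u. F' u (X u)) has_derivative h') (at u0)"
  shows "((\<lambda>u. F' u (X u0)) has_derivative (\<lambda>k. h' k - F' u0 (X' k))) (at u0)"
proof -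
  have X'_lin: "bounded_linear X'" using X by (rule has_derivative_bounded_linear)
  obtain B where B: "B > 0" "\<And>k. norm (X' k) \<le> norm k * B"
    using bounded_linear.pos_bounded[OF X'_lin] by blast
  obtain d1 where d1: "d1 > 0"
    "\<And>u. norm (u - u0) < d1 \<Longrightarrow> norm (X u - X u0 - X' (u - u0)) \<le> 1 * norm (u - u0)"
    using X unfolding has_derivative_at_alt by (meson zero_less_one)
  have Lip: "norm (X u - X u0) \<le> (B + 1) * norm (u - u0)" if "norm (u - u0) < d1" for u
    using norm_triangle_ineq[of "X u - X u0 - X' (u - u0)" "X' (u - u0)"] B(2)[of "u - u0"] d1(2)[OF that]
    by (simp add: algebra_simps)
  have zero: "((\<lambda>u. (F' u - F' u0) (X u - X u0)) has_derivative (\<lambda>k. 0)) (at u0)"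
    unfolding has_derivative_at_alt
  proof (intro conjI allI impI)
    fix e :: real assume e: "e > 0"
    then have e1: "e / (B + 1) > 0" using B by simp
    obtain d2 where d2: "d2 > 0" "\<And>u. norm (u - u0) < d2 \<Longrightarrow> norm (F' u - F' u0) < e / (B + 1)"
      using cont e1 unfolding continuous_at_eps_delta dist_norm by meson
    have "norm ((F' u - F' u0) (X u - X u0) - (F' u0 - F' u0) (X u0 - X u0) - 0) \<le> e * norm (u - u0)"
      if u: "norm (u - u0) < min d1 d2" for u
    proof -
      have "norm ((F' u - F' u0) (X u - X u0)) \<le> norm (F' u - F' u0) * norm (X u - X u0)"
        by (rule norm_blinfun)
      also have "\<dots> \<le> e / (B + 1) * ((B + 1) * norm (u - u0))"
        using d2(2)[of u] Lip[of u] u e1 by (intro mult_mono) auto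
      also have "\<dots> = e * norm (u - u0)" using B by simp
      finally show ?thesis by simp
    qed
    then show "\<exists>d>0. \<forall>y. norm (y - u0) < d \<longrightarrow> norm ((F' y - F' u0) (X y - X u0)
       - (F' u0 - F' u0) (X u0 - X u0) - 0) \<le> e * norm (y - u0)"
      using d1 d2 by (intro exI[of _ "min d1 d2"]) auto
  qed simp
  have fixed: "((\<lambda>u. F' u0 (X u - X u0)) has_derivative (\<lambda>k. F' u0 (X' k))) (at u0)"
    using X by (auto intro!: derivative_eq_intros)
  have "((\<lambda>u. F' u (X u) - ((F' u - F' u0) (X u - X u0) + F' u0 (X u - X u0)))
      has_derivative (\<lambda>k. h' k - (0 + F' u0 (X' k)))) (at u0)"
    by (intro has_derivative_diff has_derivative_add h zero fixed)
  then show ?thesis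
    by (simp add: blinfun.diff_left blinfun.diff_right algebra_simps)
qed

text \<open>This is \<open>X (Y F) - Y (X F) = [X,Y] F\<close> in coordinates, for functions \<open>F\<close> that need not have second
  derivatives. The terms in which the coefficients are differentiated come from freezing them at
  \<open>u0\<close>; the remaining ones cancel by symmetry.\<close>

lemma commutator_of_directional_derivatives:
  fixes F :: "'e::real_normed_vector \<Rightarrow> real" and F' :: "'e \<Rightarrow> 'e \<Rightarrow>\<^sub>L real"
  assumes W: "open W" "u0 \<in> W"
    and F: "\<And>u. u \<in> W \<Longrightarrow> (F has_derivative F' u) (at u)"
    and cont: "isCont F' u0"
    and X: "(X has_derivative X') (at u0)"
    and Y: "(Y has_derivative Y') (at u0)"
    and h: "((\<lambda>u. F' u (X u)) has_derivative h') (at u0)"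
    and g: "((\<lambda>u. F' u (Y u)) has_derivative g') (at u0)"
  shows "g' (X u0) - h' (Y u0) = F' u0 (Y' (X u0) - X' (Y u0))"
proof -
  have "h' (Y u0) - F' u0 (X' (Y u0)) = g' (X u0) - F' u0 (Y' (X u0))"
    by (rule mixed_directional_derivatives_commute[OF W F
          has_derivative_frozen_argument[OF cont X h] has_derivative_frozen_argument[OF cont Y g]])
  then show ?thesis by (simp add: blinfun.diff_right)
qed

section \<open>Calculus of continuously differentiable functions\<close>

lemma C1_onE:
  assumes "C1_on W f"
  obtains f' where "\<And>u. u \<in> W \<Longrightarrow> (f has_derivative blinfun_apply (f' u)) (at u)"
    and "continuous_on W f'" and "continuous_on W f"
proof -
  obtain f' where f': "\<forall>u\<in>W. (f has_derivative blinfun_apply (f' u)) (at u)" "continuous_on W f'"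
    using assms unfolding C1_on_def by (elim exE conjE)
  moreover have "continuous_on W f"
    by (intro continuous_at_imp_continuous_on ballI has_derivative_continuous[OF bspec[OF f'(1)]])
  ultimately show thesis
    by (intro that[of f']) auto
qed

lemma C1_onI:
  assumes "\<And>u. u \<in> W \<Longrightarrow> (f has_derivative blinfun_apply (f' u)) (at u)" "continuous_on W f'"
  shows "C1_on W f"
  unfolding C1_on_def using assms by (intro exI[of _ f'] conjI ballI)

lemma C1_on_differentiable:
  assumes "C1_on W f" "u \<in> W" shows "f differentiable (at u)"
proof (rule C1_onE[OF assms(1)])
  fix f' assume "\<And>u. u \<in> W \<Longrightarrow> (f has_derivative blinfun_apply (f' u)) (at u)"
  from differentiableI[OF this[OF assms(2)]] show ?thesis .
qed

lemma C1_on_cong: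
  assumes "open W" "\<And>u. u \<in> W \<Longrightarrow> f u = g u" "C1_on W f"
  shows "C1_on W g"
proof -
  obtain f' where f': "\<And>u. u \<in> W \<Longrightarrow> (f has_derivative blinfun_apply (f' u)) (at u)" "continuous_on W f'"
    using assms(3) by (rule C1_onE) (rule that; assumption)
  have "(g has_derivative blinfun_apply (f' u)) (at u)" if "u \<in> W" for u
    using f'(1)[OF that] assms(1) that assms(2) by (rule has_derivative_transform_within_open)
  then show ?thesis
    using f'(2) by (rule C1_onI)
qed

lemma C1_on_compose:
  assumes "C1_on W g" "C1_on U f" "f ` U \<subseteq> W"
  shows "C1_on U (\<lambda>u. g (f u))"
proof -
  obtain f' where f: "\<And>u. u \<in> U \<Longrightarrow> (f has_derivative blinfun_apply (f' u)) (at u)"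
    and f': "continuous_on U f'" and cont: "continuous_on U f"
    using assms(2) by (rule C1_onE) (rule that; assumption)
  obtain g' where g: "\<And>u. u \<in> W \<Longrightarrow> (g has_derivative blinfun_apply (g' u)) (at u)"
    and g': "continuous_on W g'"
    using assms(1) by (rule C1_onE) (rule that; assumption)
  have "continuous_on U (\<lambda>u. g' (f u))"
    using continuous_on_compose2[OF g' cont assms(3)] .
  then have "continuous_on U (\<lambda>u. g' (f u) o\<^sub>L f' u)"
    using f' by (intro bounded_bilinear.continuous_on[OF bounded_bilinear_blinfun_compose])
  moreover have "((\<lambda>u. g (f u)) has_derivative blinfun_apply (g' (f u) o\<^sub>L f' u)) (at u)"
    if "u \<in> U" for u
  proof -
    have "f u \<in> W" using that assms(3) by blast
    have "blinfun_apply (g' (f u) o\<^sub>L f' u) = (\<lambda>h. g' (f u) (f' u h))"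
      by (auto simp: blinfun_compose.rep_eq)
    then show ?thesis
      using has_derivative_compose[OF f[OF that] g[OF \<open>f u \<in> W\<close>]] by simp
  qed
  ultimately show ?thesis
    by (intro C1_onI)
qed

lemma C1_on_const: "C1_on W (\<lambda>u. k)"
  by (rule C1_onI[of _ _ "\<lambda>u. 0"]) (simp_all add: zero_blinfun.rep_eq)

lemma C1_on_bounded_linear:
  assumes "bounded_linear h" shows "C1_on W h"
  by (rule C1_onI[of _ _ "\<lambda>u. Blinfun h"])
     (simp_all add: bounded_linear_Blinfun_apply assms bounded_linear_imp_has_derivative)

lemma C1_on_add:
  assumes "C1_on W f" "C1_on W g"
  shows "C1_on W (\<lambda>u. f u + g u)"
proof -
  obtain f' where f: "\<And>u. u \<in> W \<Longrightarrow> (f has_derivative blinfun_apply (f' u)) (at u)"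
    and f': "continuous_on W f'"
    using assms(1) by (rule C1_onE) (rule that; assumption)
  obtain g' where g: "\<And>u. u \<in> W \<Longrightarrow> (g has_derivative blinfun_apply (g' u)) (at u)"
    and g': "continuous_on W g'"
    using assms(2) by (rule C1_onE) (rule that; assumption)
  have deriv: "((\<lambda>u. f u + g u) has_derivative blinfun_apply (f' u + g' u)) (at u)" if "u \<in> W" for u
  proof -
    have "blinfun_apply (f' u + g' u) = (\<lambda>h. f' u h + g' u h)"
      by (simp add: fun_eq_iff blinfun.add_left)
    then show ?thesis using has_derivative_add[OF f[OF that] g[OF that]] by simp
  qed
  show ?thesis
    by (rule C1_onI[OF deriv]) (assumption, intro continuous_on_add f' g')
qed

lemma C1_on_mult:
  fixes f g :: "'a::real_normed_vector \<Rightarrow> real"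
  assumes "C1_on W f" "C1_on W g"
  shows "C1_on W (\<lambda>u. f u * g u)"
proof -
  obtain f' where f: "\<And>u. u \<in> W \<Longrightarrow> (f has_derivative blinfun_apply (f' u)) (at u)"
    and f': "continuous_on W f'" and fc: "continuous_on W f"
    using assms(1) by (rule C1_onE) (rule that; assumption)
  obtain g' where g: "\<And>u. u \<in> W \<Longrightarrow> (g has_derivative blinfun_apply (g' u)) (at u)"
    and g': "continuous_on W g'" and gc: "continuous_on W g"
    using assms(2) by (rule C1_onE) (rule that; assumption)
  have deriv: "((\<lambda>u. f u * g u) has_derivative blinfun_apply (f u *\<^sub>R g' u + g u *\<^sub>R f' u)) (at u)"
    if "u \<in> W" for u
  proof -
    have "blinfun_apply (f u *\<^sub>R g' u + g u *\<^sub>R f' u) = (\<lambda>h. f u * g' u h + f' u h * g u)"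
      by (simp add: fun_eq_iff blinfun.add_left blinfun.scaleR_left)
    then show ?thesis
      using has_derivative_mult[OF f[OF that] g[OF that]] by simp
  qed
  show ?thesis
    by (rule C1_onI[OF deriv]) (assumption, intro continuous_on_add continuous_on_scaleR f' g' fc gc)
qed

lemma C1_on_sum:
  assumes "\<And>i. i \<in> I \<Longrightarrow> C1_on W (f i)"
  shows "C1_on W (\<lambda>u. \<Sum>i\<in>I. f i u)"
  using assms by (induction I rule: infinite_finite_induct) (auto intro: C1_on_const C1_on_add)

lemma C1_on_vec_nth:
  assumes "C1_on W f" shows "C1_on W (\<lambda>u. f u $ i)"
  using C1_on_compose[OF C1_on_bounded_linear[OF bounded_linear_vec_nth, of UNIV i] assms] by simp

lemma C1_on_vec_lambda:
  fixes f :: "'n::finite \<Rightarrow> 'a::real_normed_vector \<Rightarrow> real"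
  assumes "\<And>i. C1_on W (f i)"
  shows "C1_on W (\<lambda>u. \<chi> i. f i u)"
proof -
  have bl: "bounded_linear (\<lambda>r::real. r *\<^sub>R (axis i 1 :: real ^ 'n))" for i
    by (rule bounded_linear_scaleR_left)
  have "C1_on W (\<lambda>u. \<Sum>i\<in>UNIV. f i u *\<^sub>R (axis i 1 :: real ^ 'n))"
    using assms by (intro C1_on_sum C1_on_compose[OF C1_on_bounded_linear[OF bl, of UNIV]]) auto
  moreover have "(\<Sum>i\<in>UNIV. f i u *\<^sub>R (axis i 1 :: real ^ 'n)) = (\<chi> i. f i u)" for u
    using basis_expansion[of "\<chi> i. f i u"] by (simp add: scalar_mult_eq_scaleR)
  ultimately show ?thesis by simp
qed

section \<open>Finite linear combinations in spaces of real-valued functions\<close>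

text \<open>Tangent vectors are real functions on functions and covectors are real functions on tangent
  vectors, in both cases with pointwise operations. Stating closure and linearity in this form treats
  the two kinds of tensor slots alike.\<close>

definition lin_closed :: "('z \<Rightarrow> real) set \<Rightarrow> bool" where
  "lin_closed W \<longleftrightarrow> W \<noteq> {} \<and> (\<forall>a\<in>W. \<forall>b\<in>W. \<forall>r. (\<lambda>z. a z + r * b z) \<in> W)"

definition lin_on :: "('z \<Rightarrow> real) set \<Rightarrow> (('z \<Rightarrow> real) \<Rightarrow> real) \<Rightarrow> bool" where
  "lin_on W F \<longleftrightarrow> (\<forall>a\<in>W. \<forall>b\<in>W. \<forall>r. F (\<lambda>z. a z + r * b z) = F a + r * F b)"

lemma lin_closedD: "lin_closed W \<Longrightarrow> a \<in> W \<Longrightarrow> b \<in> W \<Longrightarrow> (\<lambda>z. a z + r * b z) \<in> W"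
  unfolding lin_closed_def by blast

lemma lin_onD: "lin_on W F \<Longrightarrow> a \<in> W \<Longrightarrow> b \<in> W \<Longrightarrow> F (\<lambda>z. a z + r * b z) = F a + r * F b"
  unfolding lin_on_def by blast

lemma lin_on_sum:
  assumes W: "lin_closed W" and F: "lin_on W F" and "finite I" and "\<And>i. i \<in> I \<Longrightarrow> e i \<in> W"
  shows "(\<lambda>z. \<Sum>i\<in>I. k i * e i z) \<in> W \<and> F (\<lambda>z. \<Sum>i\<in>I. k i * e i z) = (\<Sum>i\<in>I. k i * F (e i))"
  using assms(3,4)
proof (induction I rule: finite_induct)
  case empty
  obtain a where a: "a \<in> W" using W unfolding lin_closed_def by blast
  have "(\<lambda>z. a z + (- 1) * a z) \<in> W" "F (\<lambda>z. a z + (- 1) * a z) = F a + (- 1) * F a"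
    by (rule lin_closedD[OF W a a], rule lin_onD[OF F a a])
  then show ?case by simp
next
  case (insert j I)
  have 1: "(\<lambda>z. \<Sum>i\<in>I. k i * e i z) \<in> W"
    "F (\<lambda>z. \<Sum>i\<in>I. k i * e i z) = (\<Sum>i\<in>I. k i * F (e i))" and 2: "e j \<in> W"
    using insert by blast+
  have "(\<lambda>z. (\<Sum>i\<in>I. k i * e i z) + k j * e j z) \<in> W"
    "F (\<lambda>z. (\<Sum>i\<in>I. k i * e i z) + k j * e j z) = F (\<lambda>z. \<Sum>i\<in>I. k i * e i z) + k j * F (e j)"
    by (rule lin_closedD[OF W 1(1) 2], rule lin_onD[OF F 1(1) 2])
  then show ?case using insert(1,2) 1(2) by (simp add: add.commute)
qed

section \<open>Charts and tangent vectors\<close>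

locale c1_manifold =
  fixes M :: "'a topology" and \<A> :: "('a, 'n::finite) chart set"
  assumes C1_manifold: "C1_manifold M \<A>"
begin

lemma topspace_eq: "topspace M = (\<Union>c\<in>\<A>. dom_chart c)"
  using C1_manifold unfolding C1_manifold_def by blast

lemma chart_domD: "c \<in> \<A> \<Longrightarrow> x \<in> dom_chart c \<Longrightarrow> x \<in> topspace M"
  using topspace_eq by blast

lemma chart_at:
  assumes "x \<in> topspace M"
  shows "chart_at \<A> x \<in> \<A>" "x \<in> dom_chart (chart_at \<A> x)"
proof -
  have "\<exists>c. c \<in> \<A> \<and> x \<in> dom_chart c"
    using assms topspace_eq by blast
  then have "chart_at \<A> x \<in> \<A> \<and> x \<in> dom_chart (chart_at \<A> x)"
    unfolding chart_at_def by (rule someI_ex)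
  then show "chart_at \<A> x \<in> \<A>" "x \<in> dom_chart (chart_at \<A> x)"
    by blast+
qed

lemma open_dom: "c \<in> \<A> \<Longrightarrow> openin M (dom_chart c)"
  using C1_manifold unfolding C1_manifold_def by blast

lemma open_img: "c \<in> \<A> \<Longrightarrow> open (img_chart c)"
  using C1_manifold unfolding C1_manifold_def by blast

lemma chart_homeo: "c \<in> \<A> \<Longrightarrow>
  homeomorphic_map (subtopology M (dom_chart c)) (top_of_set (img_chart c)) (snd c)"
  using C1_manifold unfolding C1_manifold_def by blast

lemma chart_inj: "c \<in> \<A> \<Longrightarrow> inj_on (snd c) (dom_chart c)"
  using homeomorphic_imp_injective_map[OF chart_homeo[of c]] openin_subset[OF open_dom[of c]]
  by (simp add: inf_absorb2)

lemma inv_chart_chart [simp]: "c \<in> \<A> \<Longrightarrow> x \<in> dom_chart c \<Longrightarrow> inv_chart c (snd c x) = x"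
  unfolding inv_chart_def using chart_inj by (rule inv_into_f_f)

lemma inv_chart_in: "u \<in> img_chart c \<Longrightarrow> inv_chart c u \<in> dom_chart c"
  unfolding inv_chart_def by (rule inv_into_into)

lemma open_chart_image:
  assumes "c \<in> \<A>" "openin M N" shows "open (snd c ` (dom_chart c \<inter> N))"
proof -
  have "openin (subtopology M (dom_chart c)) (dom_chart c \<inter> N)"
    using assms by (auto simp: openin_subtopology)
  then have "openin (top_of_set (img_chart c)) (snd c ` (dom_chart c \<inter> N))"
    using homeomorphic_imp_open_map[OF chart_homeo[OF assms(1)]] unfolding open_map_def by blast
  then show ?thesis
    using open_img[OF assms(1)] openin_open_trans by blast
qed

lemma transition_C1:
  "c \<in> \<A> \<Longrightarrow> d \<in> \<A> \<Longrightarrow> C1_on (snd c ` (dom_chart c \<inter> dom_chart d)) (snd d \<circ> inv_chart c)"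
  using C1_manifold unfolding C1_manifold_def by blast

lemma C1_near_has_derivative:
  assumes "C1_near M \<A> x f" "c \<in> \<A>" "x \<in> dom_chart c"
  shows "((f \<circ> inv_chart c) has_derivative frechet_derivative (f \<circ> inv_chart c) (at (snd c x)))
    (at (snd c x))"
proof -
  obtain N where "x \<in> N" "C1_on (snd c ` (dom_chart c \<inter> N)) (f \<circ> inv_chart c)"
    using assms unfolding C1_near_def by blast
  then have "(f \<circ> inv_chart c) differentiable (at (snd c x))"
    by (intro C1_on_differentiable[of "snd c ` (dom_chart c \<inter> N)"]) (use assms(3) in auto)
  then show ?thesis
    by (simp add: frechet_derivative_works)
qed

lemma chart_vec_C1:
  "C1_near M \<A> x f \<Longrightarrow> chart_vec M \<A> c x a f = frechet_derivative (f \<circ> inv_chart c) (at (snd c x)) a"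
  by (simp add: chart_vec_def)

text \<open>As an equation of functions this also covers arguments \<open>f\<close> that are not \<open>C\<^sup>1\<close> near \<open>x\<close>, at which
  both sides take the default value \<open>0\<close>.\<close>

lemma chart_vec_linear:
  assumes "c \<in> \<A>" "x \<in> dom_chart c"
  shows "chart_vec M \<A> c x (a + r *\<^sub>R b) = (\<lambda>f. chart_vec M \<A> c x a f + r * chart_vec M \<A> c x b f)"
proof
  fix f
  show "chart_vec M \<A> c x (a + r *\<^sub>R b) f = chart_vec M \<A> c x a f + r * chart_vec M \<A> c x b f"
  proof (cases "C1_near M \<A> x f")
    case True
    have "bounded_linear (frechet_derivative (f \<circ> inv_chart c) (at (snd c x)))"
      using C1_near_has_derivative[OF True assms] by (rule has_derivative_bounded_linear)
    then show ?thesis using True by (simp add: chart_vec_def linear_simps)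
  qed (simp add: chart_vec_def)
qed

lemma C1_near_coord:
  assumes "c \<in> \<A>" "x \<in> dom_chart c"
  shows "C1_near M \<A> x (coord c i)"
  unfolding C1_near_def
proof (intro exI[of _ "dom_chart c"] conjI ballI)
  fix d assume "d \<in> \<A>"
  then have "C1_on (snd d ` (dom_chart d \<inter> dom_chart c)) (\<lambda>u. (snd c \<circ> inv_chart d) u $ i)"
    using assms by (intro C1_on_vec_nth transition_C1)
  then show "C1_on (snd d ` (dom_chart d \<inter> dom_chart c)) (coord c i \<circ> inv_chart d)"
    by (simp add: coord_def comp_def)
qed (use assms open_dom in auto)

lemma chart_vec_coord:
  assumes "c \<in> \<A>" "x \<in> dom_chart c"
  shows "chart_vec M \<A> c x a (coord c i) = a $ i"
proof -
  have "((\<lambda>u. u $ i) has_derivative (\<lambda>h. h $ i)) (at (snd c x))"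
    by (rule bounded_linear_imp_has_derivative[OF bounded_linear_vec_nth])
  then have "((coord c i \<circ> inv_chart c) has_derivative (\<lambda>h. h $ i)) (at (snd c x))"
    by (rule has_derivative_transform_within_open[OF _ open_img[OF assms(1)]])
       (use assms in \<open>auto simp: coord_def\<close>)
  then show ?thesis
    using C1_near_coord[OF assms] by (simp add: chart_vec_C1 frechet_derivative_at[symmetric])
qed

text \<open>The chain rule. It shows that the vectors of one chart already exhaust the tangent space.\<close>

lemma chart_vec_change_chart:
  assumes c: "c \<in> \<A>" "x \<in> dom_chart c" and d: "d \<in> \<A>" "x \<in> dom_chart d"
  shows "chart_vec M \<A> d x a
    = chart_vec M \<A> c x (frechet_derivative (snd c \<circ> inv_chart d) (at (snd d x)) a)"
proof
  fix f
  let ?D = "frechet_derivative (snd c \<circ> inv_chart d) (at (snd d x))"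
  show "chart_vec M \<A> d x a f = chart_vec M \<A> c x (?D a) f"
  proof (cases "C1_near M \<A> x f")
    case True
    have "((snd c \<circ> inv_chart d) has_derivative ?D) (at (snd d x))"
      unfolding frechet_derivative_works[symmetric]
      by (rule C1_on_differentiable[OF transition_C1[OF d(1) c(1)]]) (use c(2) d(2) in blast)
    moreover have "((f \<circ> inv_chart c) has_derivative frechet_derivative (f \<circ> inv_chart c) (at (snd c x)))
        (at ((snd c \<circ> inv_chart d) (snd d x)))"
      using C1_near_has_derivative[OF True c] d by simp
    ultimately have "((\<lambda>u. (f \<circ> inv_chart c) ((snd c \<circ> inv_chart d) u)) has_derivative
        (\<lambda>h. frechet_derivative (f \<circ> inv_chart c) (at (snd c x)) (?D h))) (at (snd d x))"
      by (rule has_derivative_compose)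
    then have "((f \<circ> inv_chart d) has_derivative
        (\<lambda>h. frechet_derivative (f \<circ> inv_chart c) (at (snd c x)) (?D h))) (at (snd d x))"
      by (rule has_derivative_transform_within_open[OF _ open_chart_image[OF d(1) open_dom[OF c(1)]]])
         (use c d in auto)
    then show ?thesis
      using True by (simp add: chart_vec_C1 frechet_derivative_at[symmetric])
  qed (simp add: chart_vec_def)
qed

lemma tangent_space_eq:
  assumes "c \<in> \<A>" "x \<in> dom_chart c"
  shows "tangent_space M \<A> x = range (chart_vec M \<A> c x)"
  using assms chart_vec_change_chart[OF assms] unfolding tangent_space_def by blast

lemma tangent_vector_eq_chart_vec:
  assumes "c \<in> \<A>" "x \<in> dom_chart c" "v \<in> tangent_space M \<A> x"
  shows "v = chart_vec M \<A> c x (\<chi> i. v (coord c i))"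
proof -
  obtain a where "v = chart_vec M \<A> c x a"
    using assms tangent_space_eq by blast
  then show ?thesis using chart_vec_coord[OF assms(1,2)] by simp
qed

lemma C1_near_cong:
  assumes eq: "\<And>y. y \<in> topspace M \<Longrightarrow> f y = g y"
  shows "C1_near M \<A> x f = C1_near M \<A> x g"
  unfolding C1_near_def
proof (intro ex_cong1 conj_cong refl ball_cong)
  fix N d assume N: "openin M N" and d: "d \<in> \<A>"
  have "(f \<circ> inv_chart d) u = (g \<circ> inv_chart d) u" if "u \<in> snd d ` (dom_chart d \<inter> N)" for u
    using that by (auto simp: d eq[OF chart_domD[OF d]])
  then show "C1_on (snd d ` (dom_chart d \<inter> N)) (f \<circ> inv_chart d)
      = C1_on (snd d ` (dom_chart d \<inter> N)) (g \<circ> inv_chart d)"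
    using C1_on_cong[OF open_chart_image[OF d N], of "f \<circ> inv_chart d" "g \<circ> inv_chart d"]
      C1_on_cong[OF open_chart_image[OF d N], of "g \<circ> inv_chart d" "f \<circ> inv_chart d"] by metis
qed

text \<open>Charts see only the points of the manifold, so the values of a function elsewhere in the carrier type
  do not influence its derivatives.\<close>

lemma tangent_vector_cong:
  assumes v: "v \<in> tangent_space M \<A> x" and eq: "\<And>y. y \<in> topspace M \<Longrightarrow> f y = g y"
  shows "v f = v g"
proof -
  obtain c a where c: "c \<in> \<A>" "x \<in> dom_chart c" "v = chart_vec M \<A> c x a"
    using v unfolding tangent_space_def by blast
  have iff: "C1_near M \<A> x f = C1_near M \<A> x g"
    using eq by (rule C1_near_cong)
  show ?thesis
  proof (cases "C1_near M \<A> x f")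
    case True
    have "frechet_derivative (f \<circ> inv_chart c) (at (snd c x))
        = frechet_derivative (g \<circ> inv_chart c) (at (snd c x))"
      by (rule frechet_derivative_transform_within_open[OF _ open_img[OF c(1)]])
         (use C1_near_has_derivative[OF True c(1,2)] c eq chart_domD[OF c(1)]
            in \<open>auto simp: differentiable_def\<close>)
    then show ?thesis using True iff c(3) by (simp add: chart_vec_C1)
  next
    case False then show ?thesis using iff c(3) by (simp add: chart_vec_def)
  qed
qed

section \<open>Lie brackets of continuously differentiable vector fields\<close>

lemma vector_field_in_chart:
  assumes V: "vector_field M \<A> V" and c: "c \<in> \<A>" and N: "openin M N" "y \<in> dom_chart c \<inter> N"
    and f: "\<And>d. d \<in> \<A> \<Longrightarrow> C1_on (snd d ` (dom_chart d \<inter> N)) (f \<circ> inv_chart d)"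
    and F': "((f \<circ> inv_chart c) has_derivative F') (at (snd c y))"
  shows "V y f = F' (\<chi> i. V y (coord c i))"
proof -
  have "C1_near M \<A> y f"
    unfolding C1_near_def using N f by blast
  moreover have "V y = chart_vec M \<A> c y (\<chi> i. V y (coord c i))"
    using V c N chart_domD unfolding vector_field_def
    by (intro tangent_vector_eq_chart_vec) auto
  ultimately have "V y f = frechet_derivative (f \<circ> inv_chart c) (at (snd c y)) (\<chi> i. V y (coord c i))"
    by (metis chart_vec_C1)
  then show ?thesis
    by (simp add: frechet_derivative_at[OF F', symmetric])
qed

lemma C1_near_field_coord:
  assumes V: "C1_vector_field M \<A> V" and c: "c \<in> \<A>" "x \<in> dom_chart c"
  shows "C1_near M \<A> x (\<lambda>y. V y (coord c i))"
  unfolding C1_near_def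
proof (intro exI[of _ "dom_chart c"] conjI ballI)
  fix d assume d: "d \<in> \<A>"
  let ?U = "snd d ` (dom_chart d \<inter> dom_chart c)"
  have "C1_on (img_chart c) (\<lambda>u. V (inv_chart c u) (coord c i))"
    using V c(1) unfolding C1_vector_field_def by blast
  from C1_on_compose[OF this transition_C1[OF d c(1)]]
  have "C1_on ?U (\<lambda>u. V (inv_chart c ((snd c \<circ> inv_chart d) u)) (coord c i))"
    using d by fastforce
  then show "C1_on ?U ((\<lambda>y. V y (coord c i)) \<circ> inv_chart d)"
    by (rule C1_on_cong[OF open_chart_image[OF d open_dom[OF c(1)]], rotated]) (use c d in auto)
qed (use c open_dom in auto)

lemma field_coords_C1:
  assumes "C1_vector_field M \<A> V" "c \<in> \<A>"
  shows "C1_on (img_chart c) (\<lambda>u. \<chi> i. V (inv_chart c u) (coord c i))"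
  using assms unfolding C1_vector_field_def by (intro C1_on_vec_lambda) blast

text \<open>The coordinates of the bracket are the usual \<open>X\<^sup>j \<partial>\<^sub>j Y\<^sup>i - Y\<^sup>j \<partial>\<^sub>j X\<^sup>i\<close>. That this vector satisfies the
  identity for every admitted \<open>f\<close>, and not just for twice differentiable ones, is
  \<open>commutator_of_directional_derivatives\<close>.\<close>

lemma lie_bracket_exists:
  assumes X: "C1_vector_field M \<A> X" and Y: "C1_vector_field M \<A> Y" and x: "x \<in> topspace M"
  obtains w where "w \<in> tangent_space M \<A> x"
    and "\<And>f. C1_near M \<A> x f \<Longrightarrow> C1_near M \<A> x (\<lambda>y. X y f) \<Longrightarrow> C1_near M \<A> x (\<lambda>y. Y y f) \<Longrightarrow>
      w f = X x (\<lambda>y. Y y f) - Y x (\<lambda>y. X y f)"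
proof -
  define c where "c = chart_at \<A> x"
  have c: "c \<in> \<A>" "x \<in> dom_chart c" using chart_at[OF x] by (auto simp: c_def)
  define u0 where "u0 = snd c x"
  have u0: "u0 \<in> img_chart c" "inv_chart c u0 = x" using c by (auto simp: u0_def)
  define a where "a = (\<lambda>u. \<chi> i. X (inv_chart c u) (coord c i))"
  define b where "b = (\<lambda>u. \<chi> i. Y (inv_chart c u) (coord c i))"
  have XY: "vector_field M \<A> X" "vector_field M \<A> Y"
    using X Y unfolding C1_vector_field_def by blast+
  have "a differentiable (at u0)" "b differentiable (at u0)"
    unfolding a_def b_def using field_coords_C1[OF X c(1)] field_coords_C1[OF Y c(1)] u0(1)
    by (auto intro: C1_on_differentiable)
  then obtain a' b' where a': "(a has_derivative a') (at u0)" and b': "(b has_derivative b') (at u0)"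
    unfolding differentiable_def by blast
  define w where "w = chart_vec M \<A> c x (b' (a u0) - a' (b u0))"
  have "w f = X x (\<lambda>y. Y y f) - Y x (\<lambda>y. X y f)"
    if f: "C1_near M \<A> x f" "C1_near M \<A> x (\<lambda>y. X y f)" "C1_near M \<A> x (\<lambda>y. Y y f)" for f
  proof -
    obtain N where N: "openin M N" "x \<in> N"
      "\<And>c. c \<in> \<A> \<Longrightarrow> C1_on (snd c ` (dom_chart c \<inter> N)) (f \<circ> inv_chart c)"
      using f(1) unfolding C1_near_def by blast
    define W where "W = snd c ` (dom_chart c \<inter> N)"
    have W: "open W" "u0 \<in> W"
      using open_chart_image[OF c(1) N(1)] c N by (auto simp: W_def u0_def)
    have fW: "C1_on W (f \<circ> inv_chart c)" using N(3)[OF c(1)] by (simp add: W_def)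
    obtain F' where F: "\<And>u. u \<in> W \<Longrightarrow> ((f \<circ> inv_chart c) has_derivative blinfun_apply (F' u)) (at u)"
      and F': "continuous_on W F'"
      using fW by (rule C1_onE) (rule that; assumption)
    have "isCont F' u0"
      using F' W continuous_on_eq_continuous_at by blast
    have in_chart: "V (inv_chart c u) f = blinfun_apply (F' u) (\<chi> i. V (inv_chart c u) (coord c i))"
      if "vector_field M \<A> V" "u \<in> W" for V u
    proof -
      have u: "inv_chart c u \<in> dom_chart c \<inter> N" "snd c (inv_chart c u) = u"
        using that(2) c(1) by (auto simp: W_def)
      show ?thesis
        by (rule vector_field_in_chart[OF that(1) c(1) N(1) u(1) N(3)]) (use F[OF that(2)] u(2) in auto)
    qed
    define D where "D = (\<lambda>V :: 'a \<Rightarrow> 'a tvec. frechet_derivative ((\<lambda>y. V y f) \<circ> inv_chart c) (at u0))"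
    have D: "((\<lambda>u. blinfun_apply (F' u) (\<chi> i. V (inv_chart c u) (coord c i))) has_derivative D V) (at u0)"
      if "vector_field M \<A> V" "C1_near M \<A> x (\<lambda>y. V y f)" for V
      using C1_near_has_derivative[OF that(2) c] unfolding D_def u0_def[symmetric]
      by (rule has_derivative_transform_within_open[OF _ W]) (use in_chart that in auto)
    have deriv: "V x (\<lambda>y. Z y f) = D Z (\<chi> i. V (inv_chart c u0) (coord c i))"
      if "vector_field M \<A> V" "C1_near M \<A> x (\<lambda>y. Z y f)" for V Z
    proof -
      have "V x = chart_vec M \<A> c x (\<chi> i. V x (coord c i))"
        using that(1) x c unfolding vector_field_def by (intro tangent_vector_eq_chart_vec) auto
      then have "V x (\<lambda>y. Z y f) = chart_vec M \<A> c x (\<chi> i. V x (coord c i)) (\<lambda>y. Z y f)"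
        by (rule fun_cong)
      then show ?thesis
        using chart_vec_C1[OF that(2)] u0 by (simp add: D_def u0_def)
    qed
    have "D Y (a u0) - D X (b u0) = blinfun_apply (F' u0) (b' (a u0) - a' (b u0))"
      by (rule commutator_of_directional_derivatives[OF W F \<open>isCont F' u0\<close> a' b'])
        (use D XY f in \<open>auto simp: a_def b_def\<close>)
    also have "\<dots> = w f"
      using frechet_derivative_at[OF F[OF W(2)]] chart_vec_C1[OF f(1)] by (simp add: w_def u0_def)
    finally show ?thesis
      using deriv XY f by (simp add: a_def b_def)
  qed
  moreover have "w \<in> tangent_space M \<A> x"
    using c by (auto simp: w_def tangent_space_eq)
  ultimately show thesis by (rule that[rotated])
qed

text \<open>A tangent vector with the defining property is unique, because the coordinate functions of a chart
  are among the admitted \<open>f\<close>; hence the definite description denotes the vector found above.\<close>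

lemma lie_bracket:
  assumes X: "C1_vector_field M \<A> X" and Y: "C1_vector_field M \<A> Y" and x: "x \<in> topspace M"
  shows "lie_bracket M \<A> X Y x \<in> tangent_space M \<A> x"
    and "C1_near M \<A> x f \<Longrightarrow> C1_near M \<A> x (\<lambda>y. X y f) \<Longrightarrow> C1_near M \<A> x (\<lambda>y. Y y f) \<Longrightarrow>
      lie_bracket M \<A> X Y x f = X x (\<lambda>y. Y y f) - Y x (\<lambda>y. X y f)"
proof -
  let ?P = "\<lambda>w. w \<in> tangent_space M \<A> x \<and>
     (\<forall>f. C1_near M \<A> x f \<and> C1_near M \<A> x (\<lambda>y. X y f) \<and> C1_near M \<A> x (\<lambda>y. Y y f) \<longrightarrow>
        w f = X x (\<lambda>y. Y y f) - Y x (\<lambda>y. X y f))"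
  define c where "c = chart_at \<A> x"
  have c: "c \<in> \<A>" "x \<in> dom_chart c" using chart_at[OF x] by (auto simp: c_def)
  obtain w where w: "?P w"
    using lie_bracket_exists[OF X Y x] by metis
  have "w' = w" if "?P w'" for w'
  proof -
    have "w' (coord c i) = w (coord c i)" for i
      using that w C1_near_coord[OF c] C1_near_field_coord[OF X c] C1_near_field_coord[OF Y c] by simp
    then show ?thesis
      using tangent_vector_eq_chart_vec[OF c, of w] tangent_vector_eq_chart_vec[OF c, of w'] that w
      by simp
  qed
  then have "?P (lie_bracket M \<A> X Y x)"
    unfolding lie_bracket_def by (intro theI[of ?P, OF w])
  then show "lie_bracket M \<A> X Y x \<in> tangent_space M \<A> x"
    and "C1_near M \<A> x f \<Longrightarrow> C1_near M \<A> x (\<lambda>y. X y f) \<Longrightarrow> C1_near M \<A> x (\<lambda>y. Y y f) \<Longrightarrow>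
      lie_bracket M \<A> X Y x f = X x (\<lambda>y. Y y f) - Y x (\<lambda>y. X y f)"
    by blast+
qed

section \<open>Tensors at a point\<close>

abbreviation TS :: "'a \<Rightarrow> 'a tvec set" where "TS x \<equiv> tangent_space M \<A> x"
abbreviation CS :: "'a \<Rightarrow> 'a tcov set" where "CS x \<equiv> cotangent_space M \<A> x"

definition admissible :: "nat \<Rightarrow> nat \<Rightarrow> 'a \<Rightarrow> 'a tcov list \<Rightarrow> 'a tvec list \<Rightarrow> bool" where
  "admissible p q x \<alpha>s vs \<longleftrightarrow> length \<alpha>s = p \<and> set \<alpha>s \<subseteq> CS x \<and> length vs = q \<and> set vs \<subseteq> TS x"

lemma basis_vec_in: "c \<in> \<A> \<Longrightarrow> x \<in> dom_chart c \<Longrightarrow> basis_vec M \<A> c x i \<in> TS x"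
  by (simp add: basis_vec_def tangent_space_eq)

lemma chart_vec_in: "c \<in> \<A> \<Longrightarrow> x \<in> dom_chart c \<Longrightarrow> chart_vec M \<A> c x a \<in> TS x"
  by (simp add: tangent_space_eq)

lemma tangent_space_lin_closed:
  assumes "x \<in> topspace M" shows "lin_closed (TS x)"
proof -
  define c where "c = chart_at \<A> x"
  have c: "c \<in> \<A>" "x \<in> dom_chart c" using chart_at[OF assms] by (auto simp: c_def)
  show ?thesis
    unfolding lin_closed_def tangent_space_eq[OF c]
    using chart_vec_linear[OF c, symmetric] by auto
qed

lemma cotangent_spaceI:
  "\<lbrakk>lin_on (TS x) \<alpha>; \<And>v. v \<notin> TS x \<Longrightarrow> \<alpha> v = 0\<rbrakk> \<Longrightarrow> \<alpha> \<in> CS x"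
  unfolding cotangent_space_def lin_on_def by blast

lemma cotangent_lin_on: "\<alpha> \<in> CS x \<Longrightarrow> lin_on (TS x) \<alpha>"
  unfolding cotangent_space_def lin_on_def by blast

lemma cotangent_outside: "\<alpha> \<in> CS x \<Longrightarrow> v \<notin> TS x \<Longrightarrow> \<alpha> v = 0"
  unfolding cotangent_space_def by blast

lemma cotangent_space_lin_closed: "lin_closed (CS x)"
  unfolding lin_closed_def
proof (intro conjI ballI allI)
  have "(\<lambda>v. 0) \<in> CS x" by (rule cotangent_spaceI) (auto simp: lin_on_def)
  then show "CS x \<noteq> {}" by blast
  fix a b r assume a: "a \<in> CS x" and b: "b \<in> CS x"
  show "(\<lambda>z. a z + r * b z) \<in> CS x"
  proof (rule cotangent_spaceI)
    show "lin_on (TS x) (\<lambda>z. a z + r * b z)"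
      using cotangent_lin_on[OF a] cotangent_lin_on[OF b]
      unfolding lin_on_def by (simp add: algebra_simps)
  qed (simp add: cotangent_outside[OF a] cotangent_outside[OF b])
qed

lemma tangent_vector_expansion:
  assumes c: "c \<in> \<A>" "x \<in> dom_chart c" and v: "v \<in> TS x"
  shows "v = (\<lambda>f. \<Sum>i\<in>UNIV. v (coord c i) * basis_vec M \<A> c x i f)"
proof
  fix f
  have lin: "linear (\<lambda>a. chart_vec M \<A> c x a f)"
  proof (rule linearI)
    fix a b show "chart_vec M \<A> c x (a + b) f = chart_vec M \<A> c x a f + chart_vec M \<A> c x b f"
      using chart_vec_linear[OF c, of a 1 b] by simp
  next
    fix r a
    have z: "chart_vec M \<A> c x 0 f = 0"
      using fun_cong[OF chart_vec_linear[OF c, of 0 1 0], of f] by simp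
    show "chart_vec M \<A> c x (r *\<^sub>R a) f = r *\<^sub>R chart_vec M \<A> c x a f"
      using chart_vec_linear[OF c, of 0 r a] z by simp
  qed
  let ?a = "\<chi> i. v (coord c i)"
  have "?a = (\<Sum>i\<in>UNIV. v (coord c i) *\<^sub>R axis i 1)"
    using basis_expansion[of ?a] by (simp add: scalar_mult_eq_scaleR)
  then have "chart_vec M \<A> c x ?a f = chart_vec M \<A> c x (\<Sum>i\<in>UNIV. v (coord c i) *\<^sub>R axis i 1) f"
    by simp
  also have "\<dots> = (\<Sum>i\<in>UNIV. v (coord c i) * basis_vec M \<A> c x i f)"
    by (simp add: linear_sum[OF lin] linear_cmul[OF lin] basis_vec_def)
  finally show "v f = (\<Sum>i\<in>UNIV. v (coord c i) * basis_vec M \<A> c x i f)"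
    using tangent_vector_eq_chart_vec[OF c v] by simp
qed

lemma lin_on_tangent_expansion:
  assumes c: "c \<in> \<A>" "x \<in> dom_chart c" and v: "v \<in> TS x" and F: "lin_on (TS x) F"
  shows "F v = (\<Sum>i\<in>UNIV. v (coord c i) * F (basis_vec M \<A> c x i))"
  using lin_on_sum[where I = UNIV and e = "basis_vec M \<A> c x" and k = "\<lambda>i. v (coord c i)",
      OF tangent_space_lin_closed[OF chart_domD[OF c]] F]
    tangent_vector_expansion[OF c v] basis_vec_in[OF c] by simp

lemma basis_cov_apply: "v \<in> TS x \<Longrightarrow> basis_cov M \<A> c x i v = v (coord c i)"
  by (simp add: basis_cov_def)

lemma basis_cov_in:
  assumes "x \<in> topspace M" shows "basis_cov M \<A> c x i \<in> CS x"
  using tangent_space_lin_closed[OF assms]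
  by (intro cotangent_spaceI) (auto simp: lin_on_def lin_closed_def basis_cov_def)

lemma covector_expansion:
  assumes c: "c \<in> \<A>" "x \<in> dom_chart c" and \<alpha>: "\<alpha> \<in> CS x"
  shows "\<alpha> = (\<lambda>v. \<Sum>i\<in>UNIV. \<alpha> (basis_vec M \<A> c x i) * basis_cov M \<A> c x i v)"
proof
  fix v
  show "\<alpha> v = (\<Sum>i\<in>UNIV. \<alpha> (basis_vec M \<A> c x i) * basis_cov M \<A> c x i v)"
  proof (cases "v \<in> TS x")
    case True
    then show ?thesis
      using lin_on_tangent_expansion[OF c True cotangent_lin_on[OF \<alpha>]]
      by (simp add: basis_cov_apply mult.commute)
  next
    case False
    then show ?thesis using cotangent_outside[OF \<alpha>] by (simp add: basis_cov_def)
  qed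
qed

lemma lin_on_cotangent_expansion:
  assumes c: "c \<in> \<A>" "x \<in> dom_chart c" and \<alpha>: "\<alpha> \<in> CS x" and F: "lin_on (CS x) F"
  shows "F \<alpha> = (\<Sum>i\<in>UNIV. \<alpha> (basis_vec M \<A> c x i) * F (basis_cov M \<A> c x i))"
  using lin_on_sum[where I = UNIV and e = "basis_cov M \<A> c x" and k = "\<lambda>i. \<alpha> (basis_vec M \<A> c x i)",
      OF cotangent_space_lin_closed F]
    covector_expansion[OF c \<alpha>] basis_cov_in[OF chart_domD[OF c]] by simp

lemma tensor_zero: "t \<in> tensor_space M \<A> p q x \<Longrightarrow> \<not> admissible p q x \<alpha>s vs \<Longrightarrow> t \<alpha>s vs = 0"
  unfolding tensor_space_def admissible_def by blast

lemma tensor_lin_cov: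
  assumes t: "t \<in> tensor_space M \<A> p q x"
    and a: "Suc (length \<alpha>s + length \<beta>s) = p" "set \<alpha>s \<subseteq> CS x" "set \<beta>s \<subseteq> CS x"
      "length vs = q" "set vs \<subseteq> TS x"
  shows "lin_on (CS x) (\<lambda>\<gamma>. t (\<alpha>s @ \<gamma> # \<beta>s) vs)"
  unfolding lin_on_def
proof (intro ballI allI)
  fix \<alpha> \<beta> r assume "\<alpha> \<in> CS x" "\<beta> \<in> CS x"
  moreover have "length (\<alpha>s @ \<alpha> # \<beta>s) = p \<and> set (\<alpha>s @ \<alpha> # \<beta>s) \<subseteq> CS x \<and> length vs = q \<and> set vs \<subseteq> TS x"
    using a \<open>\<alpha> \<in> CS x\<close> by auto
  moreover have "length \<alpha>s < p" using a by simp
  ultimately have "t ((\<alpha>s @ \<alpha> # \<beta>s)[length \<alpha>s := \<lambda>v. \<alpha> v + r * \<beta> v]) vs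
      = t ((\<alpha>s @ \<alpha> # \<beta>s)[length \<alpha>s := \<alpha>]) vs + r * t ((\<alpha>s @ \<alpha> # \<beta>s)[length \<alpha>s := \<beta>]) vs"
    using t unfolding tensor_space_def by blast
  then show "t (\<alpha>s @ (\<lambda>z. \<alpha> z + r * \<beta> z) # \<beta>s) vs = t (\<alpha>s @ \<alpha> # \<beta>s) vs + r * t (\<alpha>s @ \<beta> # \<beta>s) vs"
    by simp
qed

lemma tensor_lin_vec:
  assumes t: "t \<in> tensor_space M \<A> p q x"
    and a: "length \<alpha>s = p" "set \<alpha>s \<subseteq> CS x"
      "Suc (length vs + length ws) = q" "set vs \<subseteq> TS x" "set ws \<subseteq> TS x"
  shows "lin_on (TS x) (\<lambda>u. t \<alpha>s (vs @ u # ws))"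
  unfolding lin_on_def
proof (intro ballI allI)
  fix v w r assume "v \<in> TS x" "w \<in> TS x"
  moreover have "length \<alpha>s = p \<and> set \<alpha>s \<subseteq> CS x \<and> length (vs @ v # ws) = q \<and> set (vs @ v # ws) \<subseteq> TS x"
    using a \<open>v \<in> TS x\<close> by auto
  moreover have "length vs < q" using a by simp
  ultimately have "t \<alpha>s ((vs @ v # ws)[length vs := \<lambda>f. v f + r * w f])
      = t \<alpha>s ((vs @ v # ws)[length vs := v]) + r * t \<alpha>s ((vs @ v # ws)[length vs := w])"
    using t unfolding tensor_space_def by blast
  then show "t \<alpha>s (vs @ (\<lambda>z. v z + r * w z) # ws) = t \<alpha>s (vs @ v # ws) + r * t \<alpha>s (vs @ w # ws)"
    by simp
qed

text \<open>Splitting the argument list at a slot replaces the list updates in the definition of a tensor by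
  linearity in the single argument between two fixed lists.\<close>

lemma tensor_spaceI:
  assumes zero: "\<And>\<alpha>s vs. \<not> admissible p q x \<alpha>s vs \<Longrightarrow> t \<alpha>s vs = 0"
    and cov: "\<And>\<alpha>s \<beta>s vs. \<lbrakk>Suc (length \<alpha>s + length \<beta>s) = p; set \<alpha>s \<subseteq> CS x; set \<beta>s \<subseteq> CS x;
      length vs = q; set vs \<subseteq> TS x\<rbrakk> \<Longrightarrow> lin_on (CS x) (\<lambda>\<gamma>. t (\<alpha>s @ \<gamma> # \<beta>s) vs)"
    and vec: "\<And>\<alpha>s vs ws. \<lbrakk>length \<alpha>s = p; set \<alpha>s \<subseteq> CS x; Suc (length vs + length ws) = q;
      set vs \<subseteq> TS x; set ws \<subseteq> TS x\<rbrakk> \<Longrightarrow> lin_on (TS x) (\<lambda>u. t \<alpha>s (vs @ u # ws))"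
  shows "t \<in> tensor_space M \<A> p q x"
proof -
  have split: "zs[k := z] = take k zs @ z # drop (Suc k) zs"
    "Suc (length (take k zs) + length (drop (Suc k) zs)) = length zs"
    "set (take k zs) \<subseteq> set zs" "set (drop (Suc k) zs) \<subseteq> set zs"
    if "k < length zs" for zs :: "'z list" and k z
    using that by (auto simp: upd_conv_take_nth_drop dest: in_set_takeD in_set_dropD)
  show ?thesis
    unfolding tensor_space_def
  proof (intro CollectI conjI allI impI ballI; (elim conjE)?)
    fix \<alpha>s vs
    assume "\<not> (length \<alpha>s = p \<and> set \<alpha>s \<subseteq> CS x \<and> length vs = q \<and> set vs \<subseteq> TS x)"
    then show "t \<alpha>s vs = 0" by (intro zero) (simp add: admissible_def)
  next
    fix \<alpha>s vs k \<alpha> \<beta> r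
    assume *: "length \<alpha>s = p" "set \<alpha>s \<subseteq> CS x" "length vs = q" "set vs \<subseteq> TS x" "k < p"
      "\<alpha> \<in> CS x" "\<beta> \<in> CS x"
    have k: "k < length \<alpha>s" using * by simp
    have "lin_on (CS x) (\<lambda>\<gamma>. t (take k \<alpha>s @ \<gamma> # drop (Suc k) \<alpha>s) vs)"
      using * split(2-4)[OF k] by (intro cov) auto
    then show "t (\<alpha>s[k := \<lambda>v. \<alpha> v + r * \<beta> v]) vs = t (\<alpha>s[k := \<alpha>]) vs + r * t (\<alpha>s[k := \<beta>]) vs"
      using * unfolding lin_on_def split(1)[OF k] by blast
  next
    fix \<alpha>s vs k v w r
    assume *: "length \<alpha>s = p" "set \<alpha>s \<subseteq> CS x" "length vs = q" "set vs \<subseteq> TS x" "k < q"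
      "v \<in> TS x" "w \<in> TS x"
    have k: "k < length vs" using * by simp
    have "lin_on (TS x) (\<lambda>u. t \<alpha>s (take k vs @ u # drop (Suc k) vs))"
      using * split(2-4)[OF k] by (intro vec) auto
    then show "t \<alpha>s (vs[k := \<lambda>f. v f + r * w f]) = t \<alpha>s (vs[k := v]) + r * t \<alpha>s (vs[k := w])"
      using * unfolding lin_on_def split(1)[OF k] by blast
  qed
qed

definition cov_tensor :: "'a \<Rightarrow> 'a tcov \<Rightarrow> 'a tensor" where
  "cov_tensor x \<alpha> = (\<lambda>\<alpha>s vs. if \<alpha>s = [] \<and> length vs = 1 \<and> set vs \<subseteq> TS x then \<alpha> (hd vs) else 0)"

lemma vec_tensor_in:
  assumes v: "v \<in> TS x" shows "vec_tensor M \<A> x v \<in> tensor_space M \<A> 1 0 x"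
proof (rule tensor_spaceI)
  fix \<alpha>s \<beta>s :: "'a tcov list" and vs :: "'a tvec list"
  assume "Suc (length \<alpha>s + length \<beta>s) = 1" "length vs = 0"
  then show "lin_on (CS x) (\<lambda>\<gamma>. vec_tensor M \<A> x v (\<alpha>s @ \<gamma> # \<beta>s) vs)"
    using cotangent_space_lin_closed unfolding lin_closed_def by (simp add: lin_on_def vec_tensor_def)
qed (auto simp: admissible_def vec_tensor_def)

lemma cov_tensor_in:
  assumes \<alpha>: "\<alpha> \<in> CS x" and x: "x \<in> topspace M"
  shows "cov_tensor x \<alpha> \<in> tensor_space M \<A> 0 1 x"
proof (rule tensor_spaceI)
  fix \<alpha>s :: "'a tcov list" and vs ws :: "'a tvec list"
  assume "length \<alpha>s = 0" "Suc (length vs + length ws) = 1"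
  then show "lin_on (TS x) (\<lambda>u. cov_tensor x \<alpha> \<alpha>s (vs @ u # ws))"
    using tangent_space_lin_closed[OF x] cotangent_lin_on[OF \<alpha>]
    unfolding lin_closed_def by (simp add: lin_on_def cov_tensor_def)
qed (auto simp: admissible_def cov_tensor_def)

lemma tensor_prod_in:
  assumes s: "s \<in> tensor_space M \<A> p q x" and t: "t \<in> tensor_space M \<A> p' q' x"
  shows "tensor_prod p q s t \<in> tensor_space M \<A> (p + p') (q + q') x"
proof (rule tensor_spaceI)
  fix \<alpha>s vs assume *: "\<not> admissible (p + p') (q + q') x \<alpha>s vs"
  have "\<not> (admissible p q x (take p \<alpha>s) (take q vs) \<and> admissible p' q' x (drop p \<alpha>s) (drop q vs))"
  proof
    assume **: "admissible p q x (take p \<alpha>s) (take q vs) \<and> admissible p' q' x (drop p \<alpha>s) (drop q vs)"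
    have "length \<alpha>s = length (take p \<alpha>s) + length (drop p \<alpha>s)"
      "set \<alpha>s = set (take p \<alpha>s) \<union> set (drop p \<alpha>s)"
      "length vs = length (take q vs) + length (drop q vs)"
      "set vs = set (take q vs) \<union> set (drop q vs)"
      by (simp, metis append_take_drop_id set_append, simp, metis append_take_drop_id set_append)
    then show False using * ** unfolding admissible_def by (metis Un_least)
  qed
  then show "tensor_prod p q s t \<alpha>s vs = 0"
    using tensor_zero[OF s] tensor_zero[OF t] unfolding tensor_prod_def by (metis mult_eq_0_iff)
next
  fix \<alpha>s \<beta>s :: "'a tcov list" and vs :: "'a tvec list"
  assume *: "Suc (length \<alpha>s + length \<beta>s) = p + p'" "set \<alpha>s \<subseteq> CS x" "set \<beta>s \<subseteq> CS x"
    "length vs = q + q'" "set vs \<subseteq> TS x"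
  have vs: "set (take q vs) \<subseteq> TS x" "set (drop q vs) \<subseteq> TS x"
    using *(5) by (auto dest: in_set_takeD in_set_dropD)
  show "lin_on (CS x) (\<lambda>\<gamma>. tensor_prod p q s t (\<alpha>s @ \<gamma> # \<beta>s) vs)"
  proof (cases "length \<alpha>s < p")
    case True
    then obtain k where k: "p = Suc (length \<alpha>s + k)" using less_imp_Suc_add by blast
    have "lin_on (CS x) (\<lambda>\<gamma>. s (\<alpha>s @ \<gamma> # take k \<beta>s) (take q vs))"
      using * vs k by (intro tensor_lin_cov[OF s]) (auto dest: in_set_takeD)
    then show ?thesis
      unfolding lin_on_def tensor_prod_def k by (simp add: algebra_simps)
  next
    case False
    have "lin_on (CS x) (\<lambda>\<gamma>. t (drop p \<alpha>s @ \<gamma> # \<beta>s) (drop q vs))"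
      using * vs False by (intro tensor_lin_cov[OF t]) (auto dest: in_set_dropD)
    then show ?thesis
      using False unfolding lin_on_def tensor_prod_def by (simp add: algebra_simps)
  qed
next
  fix \<alpha>s :: "'a tcov list" and vs ws :: "'a tvec list"
  assume *: "length \<alpha>s = p + p'" "set \<alpha>s \<subseteq> CS x"
    "Suc (length vs + length ws) = q + q'" "set vs \<subseteq> TS x" "set ws \<subseteq> TS x"
  have \<alpha>s: "set (take p \<alpha>s) \<subseteq> CS x" "set (drop p \<alpha>s) \<subseteq> CS x"
    using *(2) by (auto dest: in_set_takeD in_set_dropD)
  show "lin_on (TS x) (\<lambda>u. tensor_prod p q s t \<alpha>s (vs @ u # ws))"
  proof (cases "length vs < q")
    case True
    then obtain k where k: "q = Suc (length vs + k)" using less_imp_Suc_add by blast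
    have "lin_on (TS x) (\<lambda>u. s (take p \<alpha>s) (vs @ u # take k ws))"
      using * \<alpha>s k by (intro tensor_lin_vec[OF s]) (auto dest: in_set_takeD)
    then show ?thesis
      unfolding lin_on_def tensor_prod_def k by (simp add: algebra_simps)
  next
    case False
    have "lin_on (TS x) (\<lambda>u. t (drop p \<alpha>s) (drop q vs @ u # ws))"
      using * \<alpha>s False by (intro tensor_lin_vec[OF t]) (auto dest: in_set_dropD)
    then show ?thesis
      using False unfolding lin_on_def tensor_prod_def by (simp add: algebra_simps)
  qed
qed

lemma insert_vec_in:
  assumes t: "t \<in> tensor_space M \<A> p (Suc q) x" and v: "v \<in> TS x"
  shows "(\<lambda>\<alpha>s vs. t \<alpha>s (v # vs)) \<in> tensor_space M \<A> p q x"
proof (rule tensor_spaceI)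
  fix \<alpha>s vs assume "\<not> admissible p q x \<alpha>s vs"
  then show "t \<alpha>s (v # vs) = 0" using v by (intro tensor_zero[OF t]) (auto simp: admissible_def)
next
  fix \<alpha>s \<beta>s :: "'a tcov list" and vs :: "'a tvec list"
  assume "Suc (length \<alpha>s + length \<beta>s) = p" "set \<alpha>s \<subseteq> CS x" "set \<beta>s \<subseteq> CS x"
    "length vs = q" "set vs \<subseteq> TS x"
  then show "lin_on (CS x) (\<lambda>\<gamma>. t (\<alpha>s @ \<gamma> # \<beta>s) (v # vs))"
    using v by (intro tensor_lin_cov[OF t]) auto
next
  fix \<alpha>s :: "'a tcov list" and vs ws :: "'a tvec list"
  assume "length \<alpha>s = p" "set \<alpha>s \<subseteq> CS x" "Suc (length vs + length ws) = q"
    "set vs \<subseteq> TS x" "set ws \<subseteq> TS x"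
  then show "lin_on (TS x) (\<lambda>u. t \<alpha>s (v # vs @ u # ws))"
    using v tensor_lin_vec[OF t, of \<alpha>s "v # vs" ws] by simp
qed

lemma insert_cov_in:
  assumes t: "t \<in> tensor_space M \<A> (Suc p) q x" and \<alpha>: "\<alpha> \<in> CS x"
  shows "(\<lambda>\<alpha>s vs. t (\<alpha> # \<alpha>s) vs) \<in> tensor_space M \<A> p q x"
proof (rule tensor_spaceI)
  fix \<alpha>s vs assume "\<not> admissible p q x \<alpha>s vs"
  then show "t (\<alpha> # \<alpha>s) vs = 0" using \<alpha> by (intro tensor_zero[OF t]) (auto simp: admissible_def)
next
  fix \<alpha>s \<beta>s :: "'a tcov list" and vs :: "'a tvec list"
  assume "Suc (length \<alpha>s + length \<beta>s) = p" "set \<alpha>s \<subseteq> CS x" "set \<beta>s \<subseteq> CS x"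
    "length vs = q" "set vs \<subseteq> TS x"
  then show "lin_on (CS x) (\<lambda>\<gamma>. t (\<alpha> # \<alpha>s @ \<gamma> # \<beta>s) vs)"
    using \<alpha> tensor_lin_cov[OF t, of "\<alpha> # \<alpha>s" \<beta>s vs] by simp
next
  fix \<alpha>s :: "'a tcov list" and vs ws :: "'a tvec list"
  assume "length \<alpha>s = p" "set \<alpha>s \<subseteq> CS x" "Suc (length vs + length ws) = q"
    "set vs \<subseteq> TS x" "set ws \<subseteq> TS x"
  then show "lin_on (TS x) (\<lambda>u. t (\<alpha> # \<alpha>s) (vs @ u # ws))"
    using \<alpha> by (intro tensor_lin_vec[OF t]) auto
qed

text \<open>Inserting a vector into the first covariant slot is a contraction of \<open>t \<otimes> v\<close>, because
  \<open>v = \<epsilon>\<^sup>i(v) e\<^sub>i\<close>. In \<open>t \<otimes> v\<close> the contravariant slot of \<open>v\<close> comes after the \<open>p\<close> slots of \<open>t\<close>, so it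
  has index \<open>p\<close>.\<close>

lemma contract_vec:
  assumes x: "x \<in> topspace M" and t: "t \<in> tensor_space M \<A> p (Suc q) x" and v: "v \<in> TS x"
  shows "contract M \<A> x p 0 (tensor_prod p (Suc q) t (vec_tensor M \<A> x v)) = (\<lambda>\<alpha>s vs. t \<alpha>s (v # vs))"
proof (intro ext)
  fix \<alpha>s vs
  define c where "c = chart_at \<A> x"
  have c: "c \<in> \<A>" "x \<in> dom_chart c" using chart_at[OF x] by (auto simp: c_def)
  let ?e = "basis_vec M \<A> c x" and ?\<epsilon> = "basis_cov M \<A> c x"
  have expand: "contract M \<A> x p 0 (tensor_prod p (Suc q) t (vec_tensor M \<A> x v)) \<alpha>s vs
    = (\<Sum>i\<in>UNIV. t (take p (insert_at p (?\<epsilon> i) \<alpha>s)) (?e i # take q vs) *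
        vec_tensor M \<A> x v (drop p (insert_at p (?\<epsilon> i) \<alpha>s)) (drop q vs))"
    by (simp add: contract_def tensor_prod_def insert_at_def c_def)
  show "contract M \<A> x p 0 (tensor_prod p (Suc q) t (vec_tensor M \<A> x v)) \<alpha>s vs = t \<alpha>s (v # vs)"
  proof (cases "admissible p q x \<alpha>s vs")
    case True
    then have a: "length \<alpha>s = p" "set \<alpha>s \<subseteq> CS x" "length vs = q" "set vs \<subseteq> TS x"
      by (auto simp: admissible_def)
    have "t \<alpha>s (v # vs) = (\<Sum>i\<in>UNIV. v (coord c i) * t \<alpha>s (?e i # vs))"
      using lin_on_tangent_expansion[OF c v tensor_lin_vec[OF t, of \<alpha>s "[]" vs]] a by simp
    then show ?thesis
      unfolding expand using a basis_cov_in[OF x] v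
      by (simp add: insert_at_def vec_tensor_def basis_cov_apply mult.commute)
  next
    case False
    have "t (take p (insert_at p (?\<epsilon> i) \<alpha>s)) (?e i # take q vs) *
        vec_tensor M \<A> x v (drop p (insert_at p (?\<epsilon> i) \<alpha>s)) (drop q vs) = 0" for i
    proof (rule ccontr)
      assume "\<not> ?thesis"
      then have 1: "admissible p (Suc q) x (take p (insert_at p (?\<epsilon> i) \<alpha>s)) (?e i # take q vs)"
        and 2: "length (drop p (insert_at p (?\<epsilon> i) \<alpha>s)) = 1" "drop q vs = []"
        using tensor_zero[OF t] by (auto simp: vec_tensor_def split: if_splits)
      have "length \<alpha>s = p" using 2(1) by (auto simp: insert_at_def)
      then have "admissible p q x \<alpha>s vs" using 1 2 by (auto simp: insert_at_def admissible_def)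
      then show False using False by simp
    qed
    then have "contract M \<A> x p 0 (tensor_prod p (Suc q) t (vec_tensor M \<A> x v)) \<alpha>s vs = 0"
      unfolding expand by (intro sum.neutral ballI)
    moreover have "t \<alpha>s (v # vs) = 0"
      using False by (intro tensor_zero[OF t]) (auto simp: admissible_def)
    ultimately show ?thesis by simp
  qed
qed

text \<open>The dual of \<open>contract_vec\<close>: \<open>\<alpha> = \<alpha>(e\<^sub>i) \<epsilon>\<^sup>i\<close>, and in \<open>t \<otimes> \<alpha>\<close> the covariant slot of \<open>\<alpha>\<close> has index
  \<open>q\<close>.\<close>

lemma contract_cov:
  assumes x: "x \<in> topspace M" and t: "t \<in> tensor_space M \<A> (Suc p) q x" and \<alpha>: "\<alpha> \<in> CS x"
  shows "contract M \<A> x 0 q (tensor_prod (Suc p) q t (cov_tensor x \<alpha>)) = (\<lambda>\<alpha>s vs. t (\<alpha> # \<alpha>s) vs)"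
proof (intro ext)
  fix \<alpha>s vs
  define c where "c = chart_at \<A> x"
  have c: "c \<in> \<A>" "x \<in> dom_chart c" using chart_at[OF x] by (auto simp: c_def)
  let ?e = "basis_vec M \<A> c x" and ?\<epsilon> = "basis_cov M \<A> c x"
  have expand: "contract M \<A> x 0 q (tensor_prod (Suc p) q t (cov_tensor x \<alpha>)) \<alpha>s vs
    = (\<Sum>i\<in>UNIV. t (?\<epsilon> i # take p \<alpha>s) (take q (insert_at q (?e i) vs)) *
        cov_tensor x \<alpha> (drop p \<alpha>s) (drop q (insert_at q (?e i) vs)))"
    by (simp add: contract_def tensor_prod_def insert_at_def c_def)
  show "contract M \<A> x 0 q (tensor_prod (Suc p) q t (cov_tensor x \<alpha>)) \<alpha>s vs = t (\<alpha> # \<alpha>s) vs"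
  proof (cases "admissible p q x \<alpha>s vs")
    case True
    then have a: "length \<alpha>s = p" "set \<alpha>s \<subseteq> CS x" "length vs = q" "set vs \<subseteq> TS x"
      by (auto simp: admissible_def)
    have "t (\<alpha> # \<alpha>s) vs = (\<Sum>i\<in>UNIV. \<alpha> (?e i) * t (?\<epsilon> i # \<alpha>s) vs)"
      using lin_on_cotangent_expansion[OF c \<alpha> tensor_lin_cov[OF t, of "[]" \<alpha>s vs]] a by simp
    then show ?thesis
      unfolding expand using a basis_vec_in[OF c]
      by (simp add: insert_at_def cov_tensor_def mult.commute)
  next
    case False
    have "t (?\<epsilon> i # take p \<alpha>s) (take q (insert_at q (?e i) vs)) *
        cov_tensor x \<alpha> (drop p \<alpha>s) (drop q (insert_at q (?e i) vs)) = 0" for i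
    proof (rule ccontr)
      assume "\<not> ?thesis"
      then have 1: "admissible (Suc p) q x (?\<epsilon> i # take p \<alpha>s) (take q (insert_at q (?e i) vs))"
        and 2: "length (drop q (insert_at q (?e i) vs)) = 1" "drop p \<alpha>s = []"
        using tensor_zero[OF t] by (auto simp: cov_tensor_def split: if_splits)
      have "length vs = q" using 2(1) by (auto simp: insert_at_def)
      then have "admissible p q x \<alpha>s vs" using 1 2 by (auto simp: insert_at_def admissible_def)
      then show False using False by simp
    qed
    then have "contract M \<A> x 0 q (tensor_prod (Suc p) q t (cov_tensor x \<alpha>)) \<alpha>s vs = 0"
      unfolding expand by (intro sum.neutral ballI)
    moreover have "t (\<alpha> # \<alpha>s) vs = 0"
      using False by (intro tensor_zero[OF t]) (auto simp: admissible_def)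
    ultimately show ?thesis by simp
  qed
qed

text \<open>Finite-dimensional reflexivity: a linear form on covectors is evaluation at a vector.\<close>

lemma vec_tensor_surj:
  assumes c: "c \<in> \<A>" "x \<in> dom_chart c" and t: "t \<in> tensor_space M \<A> 1 0 x"
  shows "t = vec_tensor M \<A> x (chart_vec M \<A> c x (\<chi> i. t [basis_cov M \<A> c x i] []))"
    (is "t = vec_tensor M \<A> x ?v")
proof (intro ext)
  fix \<alpha>s vs
  show "t \<alpha>s vs = vec_tensor M \<A> x ?v \<alpha>s vs"
  proof (cases "admissible 1 0 x \<alpha>s vs")
    case True
    then obtain \<alpha> where \<alpha>: "\<alpha>s = [\<alpha>]" "vs = []" "\<alpha> \<in> CS x"
      by (auto simp: admissible_def length_Suc_conv)
    have v: "?v \<in> TS x" using chart_vec_in[OF c] .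
    have "t [\<alpha>] [] = (\<Sum>i\<in>UNIV. \<alpha> (basis_vec M \<A> c x i) * t [basis_cov M \<A> c x i] [])"
      using lin_on_cotangent_expansion[OF c \<alpha>(3) tensor_lin_cov[OF t, of "[]" "[]" "[]"]] by simp
    moreover have "\<alpha> ?v = (\<Sum>i\<in>UNIV. ?v (coord c i) * \<alpha> (basis_vec M \<A> c x i))"
      by (rule lin_on_tangent_expansion[OF c v cotangent_lin_on[OF \<alpha>(3)]])
    ultimately show ?thesis
      using \<alpha> by (simp add: vec_tensor_def chart_vec_coord[OF c] mult.commute)
  next
    case False
    then show ?thesis using tensor_zero[OF t False] by (auto simp: vec_tensor_def admissible_def)
  qed
qed

lemma cov_tensor_surj:
  assumes t: "t \<in> tensor_space M \<A> 0 1 x"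
  shows "(\<lambda>v. t [] [v]) \<in> CS x" and "t = cov_tensor x (\<lambda>v. t [] [v])"
proof -
  show "(\<lambda>v. t [] [v]) \<in> CS x"
    using tensor_lin_vec[OF t, of "[]" "[]" "[]"]
    by (intro cotangent_spaceI) (auto intro!: tensor_zero[OF t] simp: admissible_def)
  show "t = cov_tensor x (\<lambda>v. t [] [v])"
  proof (intro ext)
    fix \<alpha>s vs
    show "t \<alpha>s vs = cov_tensor x (\<lambda>v. t [] [v]) \<alpha>s vs"
    proof (cases "admissible 0 1 x \<alpha>s vs")
      case True
      then obtain v where "\<alpha>s = []" "vs = [v]" "v \<in> TS x"
        by (auto simp: admissible_def length_Suc_conv)
      then show ?thesis by (simp add: cov_tensor_def)
    next
      case False
      then show ?thesis using tensor_zero[OF t False] by (auto simp: cov_tensor_def admissible_def)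
    qed
  qed
qed

lemma tangent_vector_eqI:
  assumes "c \<in> \<A>" "x \<in> dom_chart c" "v \<in> TS x" "w \<in> TS x" "\<And>i. v (coord c i) = w (coord c i)"
  shows "v = w"
  using tangent_vector_eq_chart_vec[OF assms(1-3)] tangent_vector_eq_chart_vec[OF assms(1,2,4)] assms(5)
  by simp

lemma vec_tensor_basis_cov:
  "x \<in> topspace M \<Longrightarrow> v \<in> TS x \<Longrightarrow> vec_tensor M \<A> x v [basis_cov M \<A> c x i] [] = v (coord c i)"
  by (simp add: vec_tensor_def basis_cov_in basis_cov_apply)

section \<open>Differentiability of evaluated tensor fields\<close>

text \<open>By multilinearity the evaluation is a polynomial in the components of the arguments and of \<open>S\<close>. The
  induction expands one argument at a time; the statement proved by induction therefore has a prefix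
  of basis elements, standing for the arguments that are already expanded.\<close>

lemma C1_on_tensor_evaluation:
  assumes S: "C1_tensor_field M \<A> p q S" and d: "d \<in> \<A>"
    and gs: "\<And>g y. g \<in> set gs \<Longrightarrow> y \<in> dom_chart d \<Longrightarrow> g y \<in> CS y"
      "\<And>g i. g \<in> set gs \<Longrightarrow> C1_on (img_chart d) (\<lambda>u. g (inv_chart d u) (basis_vec M \<A> d (inv_chart d u) i))"
    and hs: "\<And>h y. h \<in> set hs \<Longrightarrow> y \<in> dom_chart d \<Longrightarrow> h y \<in> TS y"
      "\<And>h i. h \<in> set hs \<Longrightarrow> C1_on (img_chart d) (\<lambda>u. h (inv_chart d u) (coord d i))"
    and len: "length gs = p" "length hs = q"
  shows "C1_on (img_chart d) (\<lambda>u. S (inv_chart d u) (map (\<lambda>g. g (inv_chart d u)) gs) (map (\<lambda>h. h (inv_chart d u)) hs))"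
proof -
  let ?y = "inv_chart d" and ?\<epsilon> = "\<lambda>u. basis_cov M \<A> d (inv_chart d u)"
    and ?e = "\<lambda>u. basis_vec M \<A> d (inv_chart d u)"
  have St: "S y \<in> tensor_space M \<A> p q y" if "y \<in> dom_chart d" for y
    using S chart_domD[OF d that] unfolding C1_tensor_field_def by blast
  have y: "?y u \<in> dom_chart d" if "u \<in> img_chart d" for u using that by (rule inv_chart_in)
  have e: "?e u i \<in> TS (?y u)" "?\<epsilon> u i \<in> CS (?y u)" if "u \<in> img_chart d" for u i
    using basis_vec_in[OF d y[OF that]] basis_cov_in[OF chart_domD[OF d y[OF that]]] by blast+
  \<comment> \<open>Covectors first, with basis vectors in all covariant slots; the vectors are expanded afterwards.\<close>
  have covs: "C1_on (img_chart d) (\<lambda>u. S (?y u) (map (?\<epsilon> u) is @ map (\<lambda>g. g (?y u)) gs) (map (?e u) js))"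
    if "length is + length gs = p" "length js = q"
      "\<And>g y. g \<in> set gs \<Longrightarrow> y \<in> dom_chart d \<Longrightarrow> g y \<in> CS y"
      "\<And>g i. g \<in> set gs \<Longrightarrow> C1_on (img_chart d) (\<lambda>u. g (?y u) (?e u i))"
    for gs "is" js
    using that
  proof (induction gs arbitrary: "is")
    case Nil
    then show ?case using S d unfolding C1_tensor_field_def by simp
  next
    case (Cons g gs)
    have "C1_on (img_chart d) (\<lambda>u. \<Sum>i\<in>UNIV. g (?y u) (?e u i) *
        S (?y u) (map (?\<epsilon> u) (is @ [i]) @ map (\<lambda>g. g (?y u)) gs) (map (?e u) js))"
      using Cons.prems by (intro C1_on_sum C1_on_mult Cons.IH) auto
    moreover have "(\<Sum>i\<in>UNIV. g (?y u) (?e u i) *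
        S (?y u) (map (?\<epsilon> u) (is @ [i]) @ map (\<lambda>g. g (?y u)) gs) (map (?e u) js))
      = S (?y u) (map (?\<epsilon> u) is @ map (\<lambda>g. g (?y u)) (g # gs)) (map (?e u) js)"
      if u: "u \<in> img_chart d" for u
    proof -
      have lin: "lin_on (CS (?y u)) (\<lambda>\<gamma>. S (?y u) (map (?\<epsilon> u) is @ \<gamma> # map (\<lambda>g. g (?y u)) gs) (map (?e u) js))"
        using Cons.prems e[OF u] y[OF u] by (intro tensor_lin_cov[OF St[OF y[OF u]]]) auto
      show ?thesis
        using lin_on_cotangent_expansion[OF d y[OF u] _ lin, of "g (?y u)"] Cons.prems y[OF u] by simp
    qed
    ultimately show ?case by (rule C1_on_cong[OF open_img[OF d], rotated])
  qed
  have "C1_on (img_chart d) (\<lambda>u. S (?y u) (map (\<lambda>g. g (?y u)) gs) (map (?e u) js @ map (\<lambda>h. h (?y u)) hs))"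
    if "length js + length hs = q"
      "\<And>h y. h \<in> set hs \<Longrightarrow> y \<in> dom_chart d \<Longrightarrow> h y \<in> TS y"
      "\<And>h i. h \<in> set hs \<Longrightarrow> C1_on (img_chart d) (\<lambda>u. h (?y u) (coord d i))"
    for hs js
    using that
  proof (induction hs arbitrary: js)
    case Nil
    then show ?case using covs[of "[]" gs js] gs len by simp
  next
    case (Cons h hs)
    have "C1_on (img_chart d) (\<lambda>u. \<Sum>i\<in>UNIV. h (?y u) (coord d i) *
        S (?y u) (map (\<lambda>g. g (?y u)) gs) (map (?e u) (js @ [i]) @ map (\<lambda>h. h (?y u)) hs))"
      using Cons.prems by (intro C1_on_sum C1_on_mult Cons.IH) auto
    moreover have "(\<Sum>i\<in>UNIV. h (?y u) (coord d i) *
        S (?y u) (map (\<lambda>g. g (?y u)) gs) (map (?e u) (js @ [i]) @ map (\<lambda>h. h (?y u)) hs))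
      = S (?y u) (map (\<lambda>g. g (?y u)) gs) (map (?e u) js @ map (\<lambda>h. h (?y u)) (h # hs))"
      if u: "u \<in> img_chart d" for u
    proof -
      have lin: "lin_on (TS (?y u)) (\<lambda>w. S (?y u) (map (\<lambda>g. g (?y u)) gs) (map (?e u) js @ w # map (\<lambda>h. h (?y u)) hs))"
        using Cons.prems e[OF u] y[OF u] gs(1) len by (intro tensor_lin_vec[OF St[OF y[OF u]]]) auto
      show ?thesis
        using lin_on_tangent_expansion[OF d y[OF u] _ lin, of "h (?y u)"] Cons.prems y[OF u] by simp
    qed
    ultimately show ?case by (rule C1_on_cong[OF open_img[OF d], rotated])
  qed
  from this[of "[]" hs] show ?thesis using hs len by simp
qed

section \<open>Difference quotients along shifted points\<close>

lemma eventually_shifted_point_in_chart: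
  assumes x: "x \<in> topspace M"
  shows "eventually (\<lambda>\<epsilon>. snd (chart_at \<A> x) x + \<epsilon> *\<^sub>R (\<chi> i. V x (coord (chart_at \<A> x) i))
    \<in> img_chart (chart_at \<A> x)) (at 0)"
proof -
  note c = chart_at[OF x]
  have "((\<lambda>\<epsilon>. snd (chart_at \<A> x) x + \<epsilon> *\<^sub>R (\<chi> i. V x (coord (chart_at \<A> x) i)))
      \<longlongrightarrow> snd (chart_at \<A> x) x + 0 *\<^sub>R (\<chi> i. V x (coord (chart_at \<A> x) i))) (at 0)"
    by (intro tendsto_intros)
  then show ?thesis
    using topological_tendstoD[OF _ open_img[OF c(1)]] c(2) by auto
qed

lemma eventually_shifted_point:
  assumes x: "x \<in> topspace M"
  shows "eventually (\<lambda>\<epsilon>. shifted_point \<A> V x \<epsilon> \<in> topspace M) (at 0)"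
  using eventually_shifted_point_in_chart[OF x, of V]
  by (rule eventually_mono)
     (auto simp: shifted_point_def Let_def intro!: chart_domD[OF chart_at(1)[OF x]] inv_chart_in)

text \<open>The shifted points trace a straight line in the chart, whose direction has the components of \<open>V x\<close>.\<close>

lemma tendsto_along_shifted_point:
  assumes x: "x \<in> topspace M" and V: "V x \<in> TS x" and f: "C1_near M \<A> x f"
  shows "((\<lambda>\<epsilon>. (1 / \<epsilon>) * (f (shifted_point \<A> V x \<epsilon>) - f x)) \<longlongrightarrow> V x f) (at 0)"
proof -
  define c where "c = chart_at \<A> x"
  have c: "c \<in> \<A>" "x \<in> dom_chart c" using chart_at[OF x] by (auto simp: c_def)
  define a where "a = (\<chi> i. V x (coord c i))"
  let ?F = "f \<circ> inv_chart c"
  let ?D = "frechet_derivative ?F (at (snd c x))"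
  have D: "(?F has_derivative ?D) (at (snd c x))" by (rule C1_near_has_derivative[OF f c])
  have "((\<lambda>\<epsilon>. snd c x + \<epsilon> *\<^sub>R a) has_derivative (\<lambda>h. h *\<^sub>R a)) (at 0)"
    by (auto intro!: derivative_eq_intros)
  from has_derivative_compose[OF this, of ?F ?D]
  have "((\<lambda>\<epsilon>. ?F (snd c x + \<epsilon> *\<^sub>R a)) has_derivative (\<lambda>h. ?D (h *\<^sub>R a))) (at 0)"
    using D by simp
  moreover have "(\<lambda>h. ?D (h *\<^sub>R a)) = (\<lambda>h. ?D a * h)"
    by (simp add: linear_cmul[OF has_derivative_linear[OF D]] mult.commute)
  ultimately have "((\<lambda>\<epsilon>. ?F (snd c x + \<epsilon> *\<^sub>R a)) has_real_derivative ?D a) (at 0)"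
    by (simp add: has_field_derivative_def)
  then have "((\<lambda>\<epsilon>. (1 / \<epsilon>) * (?F (snd c x + \<epsilon> *\<^sub>R a) - ?F (snd c x))) \<longlongrightarrow> ?D a) (at 0)"
    by (simp add: has_field_derivative_iff)
  moreover have "V x f = ?D a"
    using fun_cong[OF tangent_vector_eq_chart_vec[OF c V], of f] chart_vec_C1[OF f, of c a]
    unfolding a_def by (rule trans)
  moreover have "?F (snd c x + \<epsilon> *\<^sub>R a) = f (shifted_point \<A> V x \<epsilon>)" for \<epsilon>
    by (simp add: shifted_point_def c_def a_def Let_def)
  moreover have "?F (snd c x) = f x"
    using c by simp
  ultimately show ?thesis by simp
qed

end

section \<open>Flat linear transports as transports of arguments\<close>

locale flat_transport = c1_manifold M \<A> for M :: "'a topology" and \<A> :: "('a, 'n::finite) chart set" +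
  fixes L :: "'a \<Rightarrow> 'a \<Rightarrow> 'a tensor \<Rightarrow> 'a tensor"
  assumes flat_linear_transport: "flat_linear_transport M \<A> L"
begin

lemma
  assumes x: "x \<in> topspace M" and y: "y \<in> topspace M" and t: "t \<in> tensor_space M \<A> p q x"
  shows transport_in: "L x y t \<in> tensor_space M \<A> p q y"
    and transport_lin: "s \<in> tensor_space M \<A> p q x \<Longrightarrow>
      L x y (\<lambda>\<alpha>s vs. s \<alpha>s vs + r * t \<alpha>s vs) = (\<lambda>\<alpha>s vs. L x y s \<alpha>s vs + r * L x y t \<alpha>s vs)"
    and transport_prod: "s \<in> tensor_space M \<A> p' q' x \<Longrightarrow>
      L x y (tensor_prod p q t s) = tensor_prod p q (L x y t) (L x y s)"
    and transport_trans: "z \<in> topspace M \<Longrightarrow> L y z (L x y t) = L x z t"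
  using assms flat_linear_transport unfolding flat_linear_transport_def by simp_all

lemma transport_refl: "x \<in> topspace M \<Longrightarrow> t \<in> tensor_space M \<A> p q x \<Longrightarrow> L x x t = t"
  using flat_linear_transport unfolding flat_linear_transport_def by blast

lemma transport_contract:
  assumes "x \<in> topspace M" "y \<in> topspace M" "t \<in> tensor_space M \<A> (Suc p) (Suc q) x" "a \<le> p" "b \<le> q"
  shows "L x y (contract M \<A> x a b t) = contract M \<A> y a b (L x y t)"
  using assms flat_linear_transport unfolding flat_linear_transport_def by simp

lemma transport_inverse:
  assumes "x \<in> topspace M" "y \<in> topspace M" "t \<in> tensor_space M \<A> p q x"
  shows "L y x (L x y t) = t"
  using assms by (simp add: transport_trans[where t = t and p = p and q = q] transport_refl[of x t p q])

text \<open>The transport of tensors of type \<open>(1,0)\<close>, read as an operation on tangent vectors;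
  \<open>vec_tensor_transport_vec\<close> states this without coordinates.\<close>

definition transport_vec :: "'a \<Rightarrow> 'a \<Rightarrow> 'a tvec \<Rightarrow> 'a tvec" where
  "transport_vec x y v = chart_vec M \<A> (chart_at \<A> y) y
     (\<chi> i. L x y (vec_tensor M \<A> x v) [basis_cov M \<A> (chart_at \<A> y) y i] [])"

definition transport_cov :: "'a \<Rightarrow> 'a \<Rightarrow> 'a tcov \<Rightarrow> 'a tcov" where
  "transport_cov x y \<alpha> = (\<lambda>w. L x y (cov_tensor x \<alpha>) [] [w])"

lemma
  assumes x: "x \<in> topspace M" and y: "y \<in> topspace M" and v: "v \<in> TS x"
  shows transport_vec_in: "transport_vec x y v \<in> TS y"
    and vec_tensor_transport_vec: "vec_tensor M \<A> y (transport_vec x y v) = L x y (vec_tensor M \<A> x v)"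
  using vec_tensor_surj[OF chart_at[OF y] transport_in[OF x y vec_tensor_in[OF v]]]
    chart_vec_in[OF chart_at[OF y]] unfolding transport_vec_def by simp_all

lemma
  assumes x: "x \<in> topspace M" and y: "y \<in> topspace M" and \<alpha>: "\<alpha> \<in> CS x"
  shows transport_cov_in: "transport_cov x y \<alpha> \<in> CS y"
    and cov_tensor_transport_cov: "cov_tensor y (transport_cov x y \<alpha>) = L x y (cov_tensor x \<alpha>)"
  using cov_tensor_surj[OF transport_in[OF x y cov_tensor_in[OF \<alpha> x]]]
  unfolding transport_cov_def by simp_all

text \<open>The definition of the transported vector uses the chart chosen at \<open>y\<close>; its coordinates in any other
  chart have the same form.\<close>

lemma transport_vec_coord:
  assumes "x \<in> topspace M" "d \<in> \<A>" "y \<in> dom_chart d" "v \<in> TS x"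
  shows "transport_vec x y v (coord d i) = L x y (vec_tensor M \<A> x v) [basis_cov M \<A> d y i] []"
proof -
  have y: "y \<in> topspace M" using assms chart_domD by blast
  then show ?thesis
    using vec_tensor_transport_vec[OF assms(1) y assms(4)] transport_vec_in[OF assms(1) y assms(4)]
    by (simp add: vec_tensor_basis_cov[symmetric])
qed

lemma transport_vec_inverse:
  assumes x: "x \<in> topspace M" and y: "y \<in> topspace M" and v: "v \<in> TS x"
  shows "transport_vec y x (transport_vec x y v) = v"
proof -
  define c where "c = chart_at \<A> x"
  have c: "c \<in> \<A>" "x \<in> dom_chart c" using chart_at[OF x] by (auto simp: c_def)
  have w: "transport_vec x y v \<in> TS y" by (rule transport_vec_in[OF x y v])
  have "transport_vec y x (transport_vec x y v) (coord c i) = v (coord c i)" for i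
    using transport_vec_coord[OF y c w] transport_inverse[OF x y vec_tensor_in[OF v]] x v
    by (simp add: vec_tensor_transport_vec[OF x y v] vec_tensor_basis_cov)
  then show ?thesis
    by (intro tangent_vector_eqI[OF c] transport_vec_in x y w v)
qed

text \<open>The unit scalar is idempotent under the tensor product, so its image is \<open>0\<close> or \<open>1\<close>. It is not \<open>0\<close>,
  because transporting back recovers the unit.\<close>

lemma transport_scalar:
  assumes x: "x \<in> topspace M" and y: "y \<in> topspace M" and t: "t \<in> tensor_space M \<A> 0 0 x"
  shows "L x y t [] [] = t [] []"
proof -
  define e :: "'a tensor" where "e = (\<lambda>\<alpha>s vs. if \<alpha>s = [] \<and> vs = [] then 1 else 0)"
  define z :: "'a tensor" where "z = (\<lambda>\<alpha>s vs. 0)"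
  have e: "e \<in> tensor_space M \<A> 0 0 x" and z: "z \<in> tensor_space M \<A> 0 0 w" for w
    by (rule tensor_spaceI; auto simp: admissible_def e_def z_def)+
  \<comment> \<open>Linearity is stated for combinations \<open>s + r t\<close>, so the zero tensor is written as one.\<close>
  have z_lin: "z = (\<lambda>\<alpha>s vs. z \<alpha>s vs + (- 1) * z \<alpha>s vs)" by (simp add: z_def)
  have Lz: "L u w z = z" if "u \<in> topspace M" "w \<in> topspace M" for u w
    by (subst z_lin, subst transport_lin[OF that z z]) (simp add: z_def)
  define k where "k = L x y e [] []"
  have "tensor_prod 0 0 e e = e"
    by (simp add: tensor_prod_def e_def fun_eq_iff)
  then have Le: "L x y e = (\<lambda>\<alpha>s vs. k * L x y e \<alpha>s vs)"
    using transport_prod[OF x y e e] by (simp add: tensor_prod_def k_def)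
  then have "k = k * k" unfolding k_def by (rule fun_cong[THEN fun_cong])
  moreover have "k \<noteq> 0"
  proof
    assume "k = 0"
    then have "L x y e = z" using Le by (simp add: z_def)
    then have "e = z" using transport_inverse[OF x y e] Lz[OF y x] by simp
    then show False unfolding e_def z_def by (metis one_neq_zero)
  qed
  ultimately have k: "k = 1" by simp
  have "t = (\<lambda>\<alpha>s vs. z \<alpha>s vs + t [] [] * e \<alpha>s vs)"
    using tensor_zero[OF t] by (auto simp: z_def e_def fun_eq_iff admissible_def)
  then have "L x y t = L x y (\<lambda>\<alpha>s vs. z \<alpha>s vs + t [] [] * e \<alpha>s vs)" by simp
  also have "\<dots> = (\<lambda>\<alpha>s vs. z \<alpha>s vs + t [] [] * L x y e \<alpha>s vs)"
    by (simp add: transport_lin[OF x y e z] Lz[OF x y])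
  finally have "L x y t [] [] = z [] [] + t [] [] * L x y e [] []" by (rule fun_cong[THEN fun_cong])
  then show ?thesis using k by (simp add: k_def z_def)
qed

lemma transport_insert_vec:
  assumes x: "x \<in> topspace M" and y: "y \<in> topspace M"
    and t: "t \<in> tensor_space M \<A> p (Suc q) x" and v: "v \<in> TS x"
  shows "L x y (\<lambda>\<alpha>s vs. t \<alpha>s (v # vs)) = (\<lambda>\<alpha>s vs. L x y t \<alpha>s (transport_vec x y v # vs))"
proof -
  have "L x y (\<lambda>\<alpha>s vs. t \<alpha>s (v # vs))
      = contract M \<A> y p 0 (L x y (tensor_prod p (Suc q) t (vec_tensor M \<A> x v)))"
    using transport_contract[OF x y, of "tensor_prod p (Suc q) t (vec_tensor M \<A> x v)" p q p 0]
      tensor_prod_in[OF t vec_tensor_in[OF v]] by (simp add: contract_vec[OF x t v])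
  also have "\<dots> = (\<lambda>\<alpha>s vs. L x y t \<alpha>s (transport_vec x y v # vs))"
    by (simp add: transport_prod[OF x y t vec_tensor_in[OF v]] vec_tensor_transport_vec[OF x y v, symmetric]
      contract_vec[OF y transport_in[OF x y t] transport_vec_in[OF x y v]])
  finally show ?thesis .
qed

lemma transport_insert_cov:
  assumes x: "x \<in> topspace M" and y: "y \<in> topspace M"
    and t: "t \<in> tensor_space M \<A> (Suc p) q x" and \<alpha>: "\<alpha> \<in> CS x"
  shows "L x y (\<lambda>\<alpha>s vs. t (\<alpha> # \<alpha>s) vs) = (\<lambda>\<alpha>s vs. L x y t (transport_cov x y \<alpha> # \<alpha>s) vs)"
proof -
  have "L x y (\<lambda>\<alpha>s vs. t (\<alpha> # \<alpha>s) vs)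
      = contract M \<A> y 0 q (L x y (tensor_prod (Suc p) q t (cov_tensor x \<alpha>)))"
    using transport_contract[OF x y, of "tensor_prod (Suc p) q t (cov_tensor x \<alpha>)" p q 0 q]
      tensor_prod_in[OF t cov_tensor_in[OF \<alpha> x]] by (simp add: contract_cov[OF x t \<alpha>])
  also have "\<dots> = (\<lambda>\<alpha>s vs. L x y t (transport_cov x y \<alpha> # \<alpha>s) vs)"
    by (simp add: transport_prod[OF x y t cov_tensor_in[OF \<alpha> x]] cov_tensor_transport_cov[OF x y \<alpha>, symmetric]
      contract_cov[OF y transport_in[OF x y t] transport_cov_in[OF x y \<alpha>]])
  finally show ?thesis .
qed

text \<open>Inserting all arguments one after the other by tensor products and contractions leaves a scalar, and
  every one of these steps commutes with the transport.\<close>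

lemma transport_preserves_evaluation:
  assumes x: "x \<in> topspace M" and y: "y \<in> topspace M"
  shows "t \<in> tensor_space M \<A> p q x \<Longrightarrow> admissible p q x \<alpha>s vs \<Longrightarrow>
    L x y t (map (transport_cov x y) \<alpha>s) (map (transport_vec x y) vs) = t \<alpha>s vs"
proof (induction \<alpha>s arbitrary: t p)
  case Nil
  then have "p = 0" by (simp add: admissible_def)
  with Nil show ?case
  proof (induction vs arbitrary: t q)
    case Nil
    then show ?case using transport_scalar[OF x y, of t] by (simp add: admissible_def)
  next
    case (Cons v vs)
    then obtain q' where q: "q = Suc q'" by (auto simp: admissible_def)
    have v: "v \<in> TS x" and vs: "admissible 0 q' x [] vs" using Cons.prems q by (auto simp: admissible_def)
    have t: "t \<in> tensor_space M \<A> 0 (Suc q') x" using Cons.prems q by simp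
    show ?case
      using Cons.IH[of "\<lambda>\<alpha>s vs. t \<alpha>s (v # vs)" q'] insert_vec_in[OF t v] vs Cons.prems(3)
      by (simp add: transport_insert_vec[OF x y t v])
  qed
next
  case (Cons \<alpha> \<alpha>s)
  then obtain p' where p: "p = Suc p'" by (auto simp: admissible_def)
  have \<alpha>: "\<alpha> \<in> CS x" and \<alpha>s: "admissible p' q x \<alpha>s vs" using Cons.prems p by (auto simp: admissible_def)
  have t: "t \<in> tensor_space M \<A> (Suc p') q x" using Cons.prems p by simp
  show ?case
    using Cons.IH[of "\<lambda>\<alpha>s vs. t (\<alpha> # \<alpha>s) vs" p'] insert_cov_in[OF t \<alpha>] \<alpha>s
    by (simp add: transport_insert_cov[OF x y t \<alpha>])
qed

text \<open>Moving the transport from the tensor to its arguments: on the right-hand side \<open>y\<close> enters only through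
  the tensor at \<open>y\<close> and the transports of fixed vectors and covectors, which makes the dependence on
  \<open>y\<close> accessible.\<close>

lemma transport_eval:
  assumes x: "x \<in> topspace M" and y: "y \<in> topspace M"
    and t: "t \<in> tensor_space M \<A> p q y" and a: "admissible p q x \<alpha>s vs"
  shows "L y x t \<alpha>s vs = t (map (transport_cov x y) \<alpha>s) (map (transport_vec x y) vs)"
  using transport_preserves_evaluation[OF x y transport_in[OF y x t] a] transport_inverse[OF y x t] by simp

lemma transport_vec_matrix:
  assumes c: "c \<in> \<A>" "x \<in> dom_chart c" and d: "d \<in> \<A>" "y \<in> dom_chart d" and v: "v \<in> TS x"
  shows "transport_vec x y v (coord d i)
    = (\<Sum>j\<in>UNIV. v (coord c j) * transport_matrix M \<A> L d c y x $ i $ j)"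
proof -
  have x: "x \<in> topspace M" and y: "y \<in> topspace M" using c d chart_domD by blast+
  have "lin_on (TS x) (\<lambda>w. transport_vec x y w (coord d i))"
    unfolding lin_on_def
  proof (intro ballI allI)
    fix a b r assume a: "a \<in> TS x" and b: "b \<in> TS x"
    have ab: "(\<lambda>z. a z + r * b z) \<in> TS x" by (rule lin_closedD[OF tangent_space_lin_closed[OF x] a b])
    have "vec_tensor M \<A> x (\<lambda>z. a z + r * b z)
        = (\<lambda>\<alpha>s vs. vec_tensor M \<A> x a \<alpha>s vs + r * vec_tensor M \<A> x b \<alpha>s vs)"
      using lin_onD[OF cotangent_lin_on a b]
      by (auto simp: vec_tensor_def fun_eq_iff length_Suc_conv)
    then show "transport_vec x y (\<lambda>z. a z + r * b z) (coord d i)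
        = transport_vec x y a (coord d i) + r * transport_vec x y b (coord d i)"
      by (simp add: transport_vec_coord[OF x d] a b ab
          transport_lin[OF x y vec_tensor_in[OF b] vec_tensor_in[OF a]])
  qed
  from lin_on_tangent_expansion[OF c v this] show ?thesis
    by (simp add: transport_vec_coord[OF x d basis_vec_in[OF c]] transport_matrix_def)
qed

text \<open>Covectors are transported by the matrix of the opposite direction: \<open>\<alpha>\<close> takes on the vector
  transported back from \<open>y\<close> to \<open>x\<close> the value that its transport takes on the original vector.\<close>

lemma transport_cov_matrix:
  assumes c: "c \<in> \<A>" "x \<in> dom_chart c" and d: "d \<in> \<A>" "y \<in> dom_chart d" and \<alpha>: "\<alpha> \<in> CS x"
  shows "transport_cov x y \<alpha> (basis_vec M \<A> d y i)
    = (\<Sum>j\<in>UNIV. \<alpha> (basis_vec M \<A> c x j) * transport_matrix M \<A> L c d x y $ j $ i)"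
proof -
  have x: "x \<in> topspace M" and y: "y \<in> topspace M" using c d chart_domD by blast+
  let ?e = "basis_vec M \<A> d y i"
  have e: "?e \<in> TS y" by (rule basis_vec_in[OF d])
  have w: "transport_vec y x ?e \<in> TS x" by (rule transport_vec_in[OF y x e])
  have "transport_cov x y \<alpha> ?e = L x y (cov_tensor x \<alpha>) [] [transport_vec x y (transport_vec y x ?e)]"
    using transport_vec_inverse[OF y x e] by (simp add: transport_cov_def)
  also have "\<dots> = \<alpha> (transport_vec y x ?e)"
    using transport_preserves_evaluation[OF x y cov_tensor_in[OF \<alpha> x], of "[]" "[transport_vec y x ?e]"] w
    by (simp add: admissible_def cov_tensor_def)
  also have "\<dots> = (\<Sum>j\<in>UNIV. transport_vec y x ?e (coord c j) * \<alpha> (basis_vec M \<A> c x j))"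
    by (rule lin_on_tangent_expansion[OF c w cotangent_lin_on[OF \<alpha>]])
  also have "\<dots> = (\<Sum>j\<in>UNIV. \<alpha> (basis_vec M \<A> c x j) * transport_matrix M \<A> L c d x y $ j $ i)"
    by (simp add: transport_vec_coord[OF y c e] transport_matrix_def mult.commute)
  finally show ?thesis .
qed

section \<open>The connection generated by a flat linear transport\<close>

text \<open>The central identity \<open>\<phi> (D V S) = V (\<phi> S)\<close> at \<open>y\<close>, where \<open>\<phi> T = (\<lambda>z. L z x (T z) \<alpha>s vs)\<close>.
  Evaluating a tensor at \<open>y\<close> on the arguments transported from \<open>x\<close> amounts to transporting it to
  \<open>x\<close>, and path independence merges this transport with the one in the difference quotient into a
  single transport with the fixed target \<open>x\<close>.\<close>

lemma generated_connection_transported: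
  assumes x: "x \<in> topspace M" and y: "y \<in> topspace M" and V: "V y \<in> TS y"
    and S: "C1_tensor_field M \<A> p q S" and a: "admissible p q x \<alpha>s vs"
    and C1: "C1_near M \<A> y (\<lambda>z. L z x (S z) \<alpha>s vs)"
  shows "generated_connection \<A> L V S y (map (transport_cov x y) \<alpha>s) (map (transport_vec x y) vs)
    = V y (\<lambda>z. L z x (S z) \<alpha>s vs)"
proof -
  let ?\<phi> = "\<lambda>z. L z x (S z) \<alpha>s vs"
  let ?\<beta>s = "map (transport_cov x y) \<alpha>s" and ?ws = "map (transport_vec x y) vs"
  have S_in: "S z \<in> tensor_space M \<A> p q z" if "z \<in> topspace M" for z
    using S that unfolding C1_tensor_field_def by blast
  have \<phi>: "L z y (S z) ?\<beta>s ?ws = ?\<phi> z" if z: "z \<in> topspace M" for z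
    using transport_eval[OF x y transport_in[OF z y S_in[OF z]] a] transport_trans[OF z y S_in[OF z] x]
    by simp
  have \<phi>y: "S y ?\<beta>s ?ws = ?\<phi> y"
    using \<phi>[OF y] transport_refl[OF y S_in[OF y]] by simp
  have "((\<lambda>\<epsilon>. (1 / \<epsilon>) * (L (shifted_point \<A> V y \<epsilon>) y (S (shifted_point \<A> V y \<epsilon>)) ?\<beta>s ?ws - S y ?\<beta>s ?ws))
      \<longlongrightarrow> V y ?\<phi>) (at 0)"
    using tendsto_along_shifted_point[where V = V, OF y V C1]
  proof (rule Lim_transform_eventually)
    show "\<forall>\<^sub>F \<epsilon> in at 0. (1 / \<epsilon>) * (?\<phi> (shifted_point \<A> V y \<epsilon>) - ?\<phi> y)
      = (1 / \<epsilon>) * (L (shifted_point \<A> V y \<epsilon>) y (S (shifted_point \<A> V y \<epsilon>)) ?\<beta>s ?ws - S y ?\<beta>s ?ws)"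
      using eventually_shifted_point[OF y, of V] by (rule eventually_mono) (simp only: \<phi> \<phi>y)
  qed
  then show ?thesis
    unfolding generated_connection_def by (intro tendsto_Lim) auto
qed

lemma generated_connection_outside:
  assumes x: "x \<in> topspace M" and S: "\<And>z. z \<in> topspace M \<Longrightarrow> S z \<in> tensor_space M \<A> p q z"
    and a: "\<not> admissible p q x \<alpha>s vs"
  shows "generated_connection \<A> L V S x \<alpha>s vs = 0"
proof -
  have "((\<lambda>\<epsilon>. (1 / \<epsilon>) * (L (shifted_point \<A> V x \<epsilon>) x (S (shifted_point \<A> V x \<epsilon>)) \<alpha>s vs - S x \<alpha>s vs))
      \<longlongrightarrow> 0) (at 0)"
  proof (rule Lim_transform_eventually[OF tendsto_const])
    show "\<forall>\<^sub>F \<epsilon> in at 0. 0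
      = (1 / \<epsilon>) * (L (shifted_point \<A> V x \<epsilon>) x (S (shifted_point \<A> V x \<epsilon>)) \<alpha>s vs - S x \<alpha>s vs)"
      using eventually_shifted_point[OF x, of V]
    proof (rule eventually_mono)
      fix \<epsilon> assume z: "shifted_point \<A> V x \<epsilon> \<in> topspace M"
      show "0 = (1 / \<epsilon>) * (L (shifted_point \<A> V x \<epsilon>) x (S (shifted_point \<A> V x \<epsilon>)) \<alpha>s vs - S x \<alpha>s vs)"
        using tensor_zero[OF transport_in[OF z x S[OF z]] a] tensor_zero[OF S[OF x] a] by simp
    qed
  qed
  then show ?thesis
    unfolding generated_connection_def by (intro tendsto_Lim) auto
qed

lemma transport_vec_refl:
  assumes x: "x \<in> topspace M" and v: "v \<in> TS x"
  shows "transport_vec x x v = v"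
proof (rule tangent_vector_eqI[OF chart_at[OF x] transport_vec_in[OF x x v] v])
  show "transport_vec x x v (coord (chart_at \<A> x) i) = v (coord (chart_at \<A> x) i)" for i
    unfolding transport_vec_coord[OF x chart_at[OF x] v] transport_refl[OF x vec_tensor_in[OF v]]
    by (rule vec_tensor_basis_cov[OF x v])
qed

lemma transport_cov_refl:
  assumes x: "x \<in> topspace M" and \<alpha>: "\<alpha> \<in> CS x"
  shows "transport_cov x x \<alpha> = \<alpha>"
  unfolding transport_cov_def transport_refl[OF x cov_tensor_in[OF \<alpha> x]]
  by (rule ext) (simp add: cov_tensor_def cotangent_outside[OF \<alpha>])

end

locale C1_flat_transport = flat_transport M \<A> L
  for M :: "'a topology" and \<A> :: "('a, 'n::finite) chart set"
    and L :: "'a \<Rightarrow> 'a \<Rightarrow> 'a tensor \<Rightarrow> 'a tensor" +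
  assumes C1_transport: "C1_transport M \<A> L"
begin

lemma
  assumes c: "c \<in> \<A>" "x \<in> dom_chart c" and d: "d \<in> \<A>"
  shows transport_matrix_C1_target:
      "C1_on (img_chart d) (\<lambda>u. transport_matrix M \<A> L d c (inv_chart d u) x $ i $ j)"
    and transport_matrix_C1_source:
      "C1_on (img_chart d) (\<lambda>u. transport_matrix M \<A> L c d x (inv_chart d u) $ i $ j)"
proof -
  let ?x = "snd c x"
  have "bounded_linear (\<lambda>u :: real ^ 'n. (u, 0 :: real ^ 'n))"
    and "bounded_linear (\<lambda>u :: real ^ 'n. (0 :: real ^ 'n, u))"
    by (intro bounded_linear_Pair bounded_linear_ident bounded_linear_zero)+
  note linear = this[THEN C1_on_bounded_linear, of "img_chart d"]
  have "C1_on (img_chart d) (\<lambda>u. (u, 0 :: real ^ 'n) + (0, ?x))"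
    by (rule C1_on_add[OF linear(1) C1_on_const])
  moreover have "C1_on (img_chart d) (\<lambda>u. (0 :: real ^ 'n, u) + (?x, 0))"
    by (rule C1_on_add[OF linear(2) C1_on_const])
  ultimately have p1: "C1_on (img_chart d) (\<lambda>u. (u, ?x))" and p2: "C1_on (img_chart d) (\<lambda>u. (?x, u))"
    by simp_all
  have t1: "C1_on (img_chart d \<times> img_chart c)
      (\<lambda>(u, v). transport_matrix M \<A> L d c (inv_chart d u) (inv_chart c v))"
    and t2: "C1_on (img_chart c \<times> img_chart d)
      (\<lambda>(u, v). transport_matrix M \<A> L c d (inv_chart c u) (inv_chart d v))"
    using C1_transport c(1) d unfolding C1_transport_def by blast+
  have "C1_on (img_chart d) (\<lambda>u. transport_matrix M \<A> L d c (inv_chart d u) x)"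
    using C1_on_compose[OF t1 p1] c by auto
  then show "C1_on (img_chart d) (\<lambda>u. transport_matrix M \<A> L d c (inv_chart d u) x $ i $ j)"
    by (intro C1_on_vec_nth)
  have "C1_on (img_chart d) (\<lambda>u. transport_matrix M \<A> L c d x (inv_chart d u))"
    using C1_on_compose[OF t2 p2] c by auto
  then show "C1_on (img_chart d) (\<lambda>u. transport_matrix M \<A> L c d x (inv_chart d u) $ i $ j)"
    by (intro C1_on_vec_nth)
qed

lemma transport_vec_C1:
  assumes x: "x \<in> topspace M" and v: "v \<in> TS x" and d: "d \<in> \<A>"
  shows "C1_on (img_chart d) (\<lambda>u. transport_vec x (inv_chart d u) v (coord d i))"
proof -
  note c = chart_at[OF x]
  have "C1_on (img_chart d) (\<lambda>u. \<Sum>j\<in>UNIV. v (coord (chart_at \<A> x) j) *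
      transport_matrix M \<A> L d (chart_at \<A> x) (inv_chart d u) x $ i $ j)"
    by (intro C1_on_sum C1_on_mult C1_on_const transport_matrix_C1_target c d)
  then show ?thesis
    by (rule C1_on_cong[OF open_img[OF d], rotated])
      (rule transport_vec_matrix[OF c d inv_chart_in v, symmetric])
qed

lemma transport_cov_C1:
  assumes x: "x \<in> topspace M" and \<alpha>: "\<alpha> \<in> CS x" and d: "d \<in> \<A>"
  shows "C1_on (img_chart d) (\<lambda>u. transport_cov x (inv_chart d u) \<alpha> (basis_vec M \<A> d (inv_chart d u) i))"
proof -
  note c = chart_at[OF x]
  have "C1_on (img_chart d) (\<lambda>u. \<Sum>j\<in>UNIV. \<alpha> (basis_vec M \<A> (chart_at \<A> x) x j) *
      transport_matrix M \<A> L (chart_at \<A> x) d x (inv_chart d u) $ j $ i)"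
    by (intro C1_on_sum C1_on_mult C1_on_const transport_matrix_C1_source c d)
  then show ?thesis
    by (rule C1_on_cong[OF open_img[OF d], rotated])
      (rule transport_cov_matrix[OF c d inv_chart_in \<alpha>, symmetric])
qed

text \<open>The value is \<open>S z\<close> evaluated on transported arguments, whose components are \<open>C\<^sup>1\<close> in \<open>z\<close> because the
  transport matrices are.\<close>

lemma transported_component_C1:
  assumes S: "C1_tensor_field M \<A> p q S" and x: "x \<in> topspace M" and a: "admissible p q x \<alpha>s vs"
    and y: "y \<in> topspace M"
  shows "C1_near M \<A> y (\<lambda>z. L z x (S z) \<alpha>s vs)"
  unfolding C1_near_def
proof (intro exI[of _ "topspace M"] conjI ballI)
  fix d assume d: "d \<in> \<A>"
  let ?gs = "map (\<lambda>\<alpha> z. transport_cov x z \<alpha>) \<alpha>s" and ?hs = "map (\<lambda>v z. transport_vec x z v) vs"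
  have a': "length \<alpha>s = p" "set \<alpha>s \<subseteq> CS x" "length vs = q" "set vs \<subseteq> TS x"
    using a by (auto simp: admissible_def)
  have "C1_on (img_chart d) (\<lambda>u. S (inv_chart d u) (map (\<lambda>g. g (inv_chart d u)) ?gs) (map (\<lambda>h. h (inv_chart d u)) ?hs))"
    using a' transport_cov_in[OF x chart_domD[OF d]] transport_vec_in[OF x chart_domD[OF d]]
      transport_cov_C1[OF x _ d] transport_vec_C1[OF x _ d]
    by (intro C1_on_tensor_evaluation[OF S d]) auto
  then have "C1_on (img_chart d) ((\<lambda>z. L z x (S z) \<alpha>s vs) \<circ> inv_chart d)"
  proof (rule C1_on_cong[OF open_img[OF d], rotated])
    fix u assume "u \<in> img_chart d"
    then have z: "inv_chart d u \<in> topspace M" using chart_domD[OF d inv_chart_in] by blast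
    then have "S (inv_chart d u) \<in> tensor_space M \<A> p q (inv_chart d u)"
      using S unfolding C1_tensor_field_def by blast
    from transport_eval[OF x z this a]
    show "S (inv_chart d u) (map (\<lambda>g. g (inv_chart d u)) ?gs) (map (\<lambda>h. h (inv_chart d u)) ?hs)
        = ((\<lambda>z. L z x (S z) \<alpha>s vs) \<circ> inv_chart d) u"
      by (simp add: comp_def)
  qed
  moreover have "dom_chart d \<inter> topspace M = dom_chart d" using chart_domD[OF d] by blast
  ultimately show "C1_on (snd d ` (dom_chart d \<inter> topspace M)) ((\<lambda>z. L z x (S z) \<alpha>s vs) \<circ> inv_chart d)"
    by simp
qed (use y in auto)

text \<open>With \<open>f = \<phi> S\<close>, the three terms of the curvature are \<open>X (Y f)\<close>, \<open>Y (X f)\<close> and \<open>[X,Y] f\<close>. The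
  assumptions on \<open>D X S\<close> and \<open>D Y S\<close> make \<open>X f\<close> and \<open>Y f\<close> \<open>C\<^sup>1\<close>, as the bracket identity
  requires.\<close>

lemma curvature_zero:
  assumes X: "C1_vector_field M \<A> X" and Y: "C1_vector_field M \<A> Y" and S: "C1_tensor_field M \<A> p q S"
    and DX: "C1_tensor_field M \<A> p q (generated_connection \<A> L X S)"
    and DY: "C1_tensor_field M \<A> p q (generated_connection \<A> L Y S)"
    and x: "x \<in> topspace M"
  shows "curvature M \<A> (generated_connection \<A> L) X Y S x \<alpha>s vs = 0"
proof -
  let ?D = "generated_connection \<A> L" and ?Z = "lie_bracket M \<A> X Y"
  have field: "V y \<in> TS y" if "C1_vector_field M \<A> V" "y \<in> topspace M" for V y
    using that unfolding C1_vector_field_def vector_field_def by blast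
  have Z: "?Z x \<in> TS x" by (rule lie_bracket(1)[OF X Y x])
  have tensor: "T z \<in> tensor_space M \<A> p q z" if "C1_tensor_field M \<A> p q T" "z \<in> topspace M" for T z
    using that unfolding C1_tensor_field_def by blast
  show ?thesis
  proof (cases "admissible p q x \<alpha>s vs")
    case False
    show ?thesis
      using generated_connection_outside[OF x tensor[OF DX] False] generated_connection_outside[OF x tensor[OF DY] False]
        generated_connection_outside[OF x tensor[OF S] False] by (simp add: curvature_def)
  next
    case a: True
    define \<phi> where "\<phi> = (\<lambda>T z. L z x (T z) \<alpha>s vs)"
    have \<phi>_C1: "C1_near M \<A> y (\<phi> T)" if "C1_tensor_field M \<A> p q T" "y \<in> topspace M" for T y
      unfolding \<phi>_def by (rule transported_component_C1[OF that(1) x a that(2)])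
    \<comment> \<open>At \<open>x\<close> itself the transport of the arguments is trivial. Only the value of \<open>V\<close> at \<open>x\<close> matters
      here, so that this applies to the Lie bracket, which need not be a \<open>C\<^sup>1\<close> field.\<close>
    have at_x: "?D V T x \<alpha>s vs = V x (\<phi> T)" if "V x \<in> TS x" "C1_tensor_field M \<A> p q T" for V T
    proof -
      have "map (transport_cov x x) \<alpha>s = \<alpha>s" "map (transport_vec x x) vs = vs"
        using a x by (auto simp: admissible_def transport_vec_refl transport_cov_refl intro!: map_idI)
      then show ?thesis
        using generated_connection_transported[where V = V, OF x x that a] \<phi>_C1[OF that(2) x] by (simp add: \<phi>_def)
    qed
    have \<phi>_D: "\<phi> (?D V S) y = V y (\<phi> S)"
      if V: "C1_vector_field M \<A> V" "C1_tensor_field M \<A> p q (?D V S)" and y: "y \<in> topspace M" for V y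
      using generated_connection_transported[where V = V, OF x y field[OF V(1) y] S a] \<phi>_C1[OF S y]
        transport_eval[OF x y tensor[OF V(2) y] a] by (simp add: \<phi>_def)
    have C1_deriv: "C1_near M \<A> x (\<lambda>y. V y (\<phi> S))"
      if V: "C1_vector_field M \<A> V" "C1_tensor_field M \<A> p q (?D V S)" for V
      using C1_near_cong[of "\<phi> (?D V S)" "\<lambda>y. V y (\<phi> S)" x, OF \<phi>_D[OF V]] \<phi>_C1[OF V(2) x] by simp
    have "?D X (?D Y S) x \<alpha>s vs = X x (\<lambda>y. Y y (\<phi> S))"
      using at_x[where V = X, OF field[OF X x] DY] tangent_vector_cong[OF field[OF X x] \<phi>_D[OF Y DY]] by simp
    moreover have "?D Y (?D X S) x \<alpha>s vs = Y x (\<lambda>y. X y (\<phi> S))"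
      using at_x[where V = Y, OF field[OF Y x] DX] tangent_vector_cong[OF field[OF Y x] \<phi>_D[OF X DX]] by simp
    moreover have "?D ?Z S x \<alpha>s vs = X x (\<lambda>y. Y y (\<phi> S)) - Y x (\<lambda>y. X y (\<phi> S))"
      using at_x[where V = ?Z, OF Z S] lie_bracket(2)[OF X Y x \<phi>_C1[OF S x] C1_deriv[OF X DX] C1_deriv[OF Y DY]] by simp
    ultimately show ?thesis by (simp add: curvature_def)
  qed
qed

end

theorem proposition3p3:
  fixes M :: "'a topology"
    and \<A> :: "('a, 'n::finite) chart set"
    and L :: "'a \<Rightarrow> 'a \<Rightarrow> 'a tensor \<Rightarrow> 'a tensor"
  assumes "C1_manifold M \<A>"
    and "flat_linear_transport M \<A> L"
    and "C1_transport M \<A> L"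
  shows "flat_connection M \<A> (generated_connection \<A> L)"
proof -
  interpret C1_flat_transport M \<A> L
    by unfold_locales (rule assms)+
  show ?thesis
    unfolding flat_connection_def
    by (intro allI impI ballI ext, elim conjE) (rule curvature_zero)
qed

end
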